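(* Suppose there exist a function $\gamma$ on $\mathbb{R}^+=[0,\infty)$ that is Lipschitz with constant $C_L$ and numbers $\delta_N\ge 0$ ($N\ge1$) such that for every $N$ $$\sup_{x}\Bigl|\gamma_N(x)-\gamma\Bigl(\frac{x}{N}\Bigr)\Bigr|\le \delta_N .$$ Let $z$ be the solution of $\dot z=1+\gamma(z)$, $z(0)=0$, let $T^*$ be the solution of $z(T^* )=1$, let $$T_N^*=\inf\{\tau\in\mathbb N_+ : Z_\tau=N\},$$ and let $\omega_N=\bigl(\delta_N+2\sqrt{2C_N}\bigr)e^{C_L}$ with $C_N=\bar\psi_N/N$. Then for all $\delta>0$ there exists a constant $C_\delta$ depending only on $\delta$ (in particular not on $N$) such that $$\mathbb P\Bigl[\Bigl|\frac{T_N^*}{N}-T^*\Bigr|\ge\delta\Bigr]\le C_\delta\,\omega_N .$$ Furthermore, if there exist constants $\varepsilon,c_1>0$ such that $\gamma(z(s))\le1-\varepsilon$ for all $s\ge c_1$, then there exists a constant $C$ (not depending on $N$) such that $$\Bigl\lVert\frac{T_N^*}{N}-T^*\Bigr\rVert_2\le C\,\omega_N .$$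
   Context: Setting. For each $N\ge1$, items $V=\{1,\dots,N\}$ are the vertices of a random graph $\mathcal G$. Initially no item is explored. At each step one not-yet-explored item is selected and becomes active, and its neighbors among the not-yet-explored items become explored as well; the algorithm stops when all items are active or explored, so $T_N^*$ is the final number of active items. Homogeneity assumption: if $(\mathcal G_1,\mathcal G_2)$ is a partition of $\mathcal G$ and $i\in\mathcal G_2$, the distribution of the number of neighbors of $i$ in $\mathcal G_2$ depends only on $|\mathcal G_1|$ and $|\mathcal G_2|$. For $|\mathcal G_1|=x$ this distribution is denoted $p_N(\cdot,x)$, $x\in\{0,\dots,N-1\}$ (a probability distribution on $\{0,\dots,N-x-1\}$). Let $Z_n$ be the total number of items that are active or explored after $n$ steps. Then $Z=(Z_n)_{n\ge0}$ is a discrete-time Markov chain on $\{0,\dots,N\}$ with $Z_0=0$, transition probabilities $P(Z_n=x+k+1\mid Z_{n-1}=x)=p_N(k,x)$ for $k\ge0$, $x<N$, and absorbing state $N$. Notation. $\gamma_N(x)=\sum_{k=0}^{N-1}k\,p_N(k,x)$ and $\psi_N(x)=\sum_{k=0}^{N-1}(k-\gamma_N(x))^2p_N(k,x)$ are the mean and variance of $p_N(\cdot,x)$; $\bar\psi_N=\sup_x\psi_N(x)$; suprema over $x$ are over $x\in\{0,\dots,N-1\}$. For a random variable $X$, $\lVert X\rVert_2=(\mathbb E|X|^2)^{1/2}$.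
   Formalization: The bounds fail for some single N (N=1, γ(x)=x, δ_1=0 gives ω_1=0 but T_1^*=1≠T*=ln 2), so they are proved for all large N (C_δ depending only on δ, for sample spaces of one fixed type) and for every N with ω_N>0 with a constant that depends on the data but not on N. *)

theory Defs
  imports "HOL-Probability.Probability"
begin

text \<open>\<open>p N x\<close> is the law \<open>p\<^sub>N(\<cdot>, x)\<close> of the number of unexplored neighbours of the item
  selected when \<open>x\<close> of the \<open>N\<close> items are active or explored. It is meaningful only for
  \<open>x < N\<close>; its values for \<open>x \<ge> N\<close> are never used.\<close>

type_synonym neighbour_laws = "nat \<Rightarrow> nat \<Rightarrow> nat pmf"

definition neighbour_laws :: "neighbour_laws \<Rightarrow> bool" where
  "neighbour_laws p \<longleftrightarrow> (\<forall>N x. x < N \<longrightarrow> set_pmf (p N x) \<subseteq> {0..N - x - 1})"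

definition nb_mean :: "neighbour_laws \<Rightarrow> nat \<Rightarrow> nat \<Rightarrow> real" where
  "nb_mean p N x = (\<Sum>k = 0..N - 1. real k * pmf (p N x) k)"

definition nb_var :: "neighbour_laws \<Rightarrow> nat \<Rightarrow> nat \<Rightarrow> real" where
  "nb_var p N x = (\<Sum>k = 0..N - 1. (real k - nb_mean p N x)\<^sup>2 * pmf (p N x) k)"

definition nb_var_sup :: "neighbour_laws \<Rightarrow> nat \<Rightarrow> real" where
  "nb_var_sup p N = (SUP x\<in>{0..N - 1}. nb_var p N x)"

definition step_law :: "neighbour_laws \<Rightarrow> nat \<Rightarrow> nat \<Rightarrow> nat pmf" where
  "step_law p N x = (if x < N then map_pmf (\<lambda>k. x + k + 1) (p N x) else return_pmf N)"

definition markov_chain_from ::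
    "'a measure \<Rightarrow> (nat \<Rightarrow> 'a \<Rightarrow> 's) \<Rightarrow> 's set \<Rightarrow> ('s \<Rightarrow> 's pmf) \<Rightarrow> 's \<Rightarrow> bool" where
  "markov_chain_from M Z S K s0 \<longleftrightarrow>
     prob_space M \<and>
     (\<forall>n. Z n \<in> measurable M (count_space S)) \<and>
     (AE \<omega> in M. Z 0 \<omega> = s0) \<and>
     (\<forall>n path y.
        measure M {\<omega> \<in> space M. \<forall>i\<le>n. Z i \<omega> = path i} > 0 \<longrightarrow>
        cond_prob M (\<lambda>\<omega>. Z (Suc n) \<omega> = y) (\<lambda>\<omega>. \<forall>i\<le>n. Z i \<omega> = path i)
          = pmf (K (path n)) y)"

definition exploration_chain ::
    "neighbour_laws \<Rightarrow> nat \<Rightarrow> 'a measure \<Rightarrow> (nat \<Rightarrow> 'a \<Rightarrow> nat) \<Rightarrow> bool" where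
  "exploration_chain p N M Z \<longleftrightarrow> markov_chain_from M Z {0..N} (step_law p N) 0"

text \<open>Before absorption the chain increases by at least one in every step, so for \<open>N \<ge> 1\<close> the
  set below is almost surely nonempty. On the remaining null event the infimum on \<open>nat\<close> is
  \<open>0\<close> by convention.\<close>

definition final_time :: "nat \<Rightarrow> (nat \<Rightarrow> 'a \<Rightarrow> nat) \<Rightarrow> 'a \<Rightarrow> nat" where
  "final_time N Z \<omega> = Inf {\<tau>. 1 \<le> \<tau> \<and> Z \<tau> \<omega> = N}"

text \<open>The rate below contains no term for the time discretisation, so for an individual \<open>N\<close> it can
  vanish although the error does not. Example: \<open>N = 1\<close> forces
  \<open>nb_mean p 1 0 = nb_var p 1 0 = 0\<close>, so for \<open>\<gamma> x = x\<close> and \<open>d 1 = 0\<close> the rate is \<open>0\<close>, whereas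
  \<open>final_time = 1\<close> almost surely and \<open>Tstar = ln 2\<close>. Taking \<open>d 1\<close> small and positive instead shows
  that no constant depending only on \<open>\<delta>\<close> works for \<open>N = 1\<close>. A bound with a constant depending
  only on \<open>\<delta>\<close> can therefore hold only for all sufficiently large \<open>N\<close> (depending on the
  data), and a bound for every \<open>N \<ge> 1\<close>, with a constant depending on the data but not on
  \<open>N\<close>, only where the rate is positive.\<close>

definition omega_rate :: "neighbour_laws \<Rightarrow> real \<Rightarrow> (nat \<Rightarrow> real) \<Rightarrow> nat \<Rightarrow> real" where
  "omega_rate p L d N = (d N + 2 * sqrt (2 * (nb_var_sup p N / real N))) * exp L"

text \<open>The function \<open>\<gamma>\<close> lives on \<open>[0, \<infinity>)\<close>, hence the requirement that the solution \<open>z\<close> stays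
  there; values of \<open>\<gamma>\<close> and \<open>z\<close> at negative arguments are irrelevant.\<close>

definition fluid_solution :: "(real \<Rightarrow> real) \<Rightarrow> (real \<Rightarrow> real) \<Rightarrow> bool" where
  "fluid_solution \<gamma> z \<longleftrightarrow>
     z 0 = 0 \<and>
     (\<forall>t\<ge>0. 0 \<le> z t \<and> (z has_real_derivative 1 + \<gamma> (z t)) (at t within {0..}))"

definition exploration_setting ::
    "neighbour_laws \<Rightarrow> (nat \<Rightarrow> 'a measure) \<Rightarrow> (nat \<Rightarrow> nat \<Rightarrow> 'a \<Rightarrow> nat) \<Rightarrow>
     (real \<Rightarrow> real) \<Rightarrow> real \<Rightarrow> (nat \<Rightarrow> real) \<Rightarrow> (real \<Rightarrow> real) \<Rightarrow> real \<Rightarrow> bool" where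
  "exploration_setting p M Z \<gamma> L d z Tstar \<longleftrightarrow>
     neighbour_laws p \<and>
     (\<forall>N\<ge>1. exploration_chain p N (M N) (Z N)) \<and>
     L-lipschitz_on {0..} \<gamma> \<and>
     (\<forall>N\<ge>1. 0 \<le> d N \<and> (SUP x\<in>{0..N - 1}. \<bar>nb_mean p N x - \<gamma> (real x / real N)\<bar>) \<le> d N) \<and>
     fluid_solution \<gamma> z \<and> 0 \<le> Tstar \<and> z Tstar = 1"

definition time_error :: "nat \<Rightarrow> (nat \<Rightarrow> nat \<Rightarrow> 'a \<Rightarrow> nat) \<Rightarrow> real \<Rightarrow> 'a \<Rightarrow> real" where
  "time_error N Z Tstar \<omega> = real (final_time N (Z N) \<omega>) / real N - Tstar"

definition L2_norm_rv :: "'a measure \<Rightarrow> ('a \<Rightarrow> real) \<Rightarrow> real" where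
  "L2_norm_rv M X = sqrt (\<integral>\<omega>. \<bar>X \<omega>\<bar>\<^sup>2 \<partial>M)"

end

theory Submission
  imports Defs
begin

text \<open>Call the deviation \<open>Z\<^sub>n / N - z (n / N)\<close>, frozen at absorption, the stopped error. One step
  changes its conditional mean by a factor at most \<open>1 + L / N\<close>, up to the drift and the discretisation
  error, and adds a centred increment of variance at most \<open>nb_var_sup p N / N\<^sup>2\<close>. Hence, by a discrete
  Gronwall argument, its \<open>L\<^sup>2\<close> norm at any time \<open>m \<le> N\<close> is at most \<open>omega_rate p L d N + O(1/N)\<close>.

  If \<open>d N \<le> 1/4\<close> for a single large \<open>N\<close>, then \<open>\<gamma> \<ge> -1/2\<close> on \<open>[0, 1]\<close>, and the stopped error at
  time \<open>\<lfloor>N Tstar\<rfloor>\<close> controls the time error, because \<open>Z\<close> gains at least one item per step and \<open>z\<close> has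
  speed at least \<open>1/2\<close> up to time \<open>Tstar\<close>. Otherwise the rate is at least \<open>1/4\<close> for large \<open>N\<close>.

  The \<open>O(1/N)\<close> term, which the rate does not contain, is harmless: either \<open>\<gamma>\<close> vanishes on \<open>[0, 1]\<close>
  and there is no discretisation error, or the rate is at least \<open>c / sqrt N\<close>. So the
  \<open>L\<^sup>2\<close> norm of the time error is eventually at most three times the rate.\<close>

subsection \<open>The fluid limit\<close>

lemma fluid_MVT:
  assumes "fluid_solution \<gamma> z" "0 \<le> a" "a < b"
  obtains \<xi> where "a < \<xi>" "\<xi> < b" "z b - z a = (1 + \<gamma> (z \<xi>)) * (b - a)"
proof -
  have "\<exists>x\<in>{a<..<b}. z b - z a = (\<lambda>h. (1 + \<gamma> (z x)) * h) (b - a)"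
  proof (rule mvt_simple[OF \<open>a < b\<close>])
    fix x assume x: "a \<le> x" "x \<le> b"
    then have "(z has_real_derivative 1 + \<gamma> (z x)) (at x within {0..})"
      using assms by (simp add: fluid_solution_def)
    then have "(z has_real_derivative 1 + \<gamma> (z x)) (at x within {a..b})"
      by (rule DERIV_subset) (use assms in auto)
    then show "(z has_derivative (*) (1 + \<gamma> (z x))) (at x within {a..b})"
      by (simp add: has_field_derivative_def)
  qed
  then show ?thesis using that by auto
qed

lemma fluid_continuous_on:
  assumes "fluid_solution \<gamma> z"
  shows "continuous_on {0..} z"
  using assms by (auto simp: fluid_solution_def intro!: DERIV_continuous_on)

text \<open>\<open>T\<close> is only some time at which \<open>z\<close> equals 1, so
  \<open>z\<close> could a priori exceed 1 before it. If it did, then at the first later time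
  \<open>u\<close> with \<open>z u \<le> 1\<close> the derivative would be at least 1/2, so
  \<open>z\<close> would be smaller just before \<open>u\<close>, contradicting minimality.\<close>

lemma fluid_le_one:
  assumes fl: "fluid_solution \<gamma> z" and T: "z T = 1"
    and pos: "\<And>y. 0 \<le> y \<Longrightarrow> y \<le> 1 \<Longrightarrow> -1/2 \<le> \<gamma> y"
    and t: "0 \<le> t" "t \<le> T"
  shows "z t \<le> 1"
proof (rule ccontr)
  assume gt: "\<not> z t \<le> 1"
  let ?A = "{t..T} \<inter> z -` {..1}"
  have "closed ?A"
    by (rule continuous_closed_preimage)
       (use t in \<open>auto intro: continuous_on_subset[OF fluid_continuous_on[OF fl]]\<close>)
  then have "compact ?A"
    using bounded_subset[of "{t..T}" ?A] by (auto simp: compact_eq_bounded_closed)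
  moreover have "T \<in> ?A"
    using T t by auto
  ultimately obtain u where u: "u \<in> ?A" "\<And>s. s \<in> ?A \<Longrightarrow> u \<le> s"
    using compact_attains_inf[of ?A] by blast
  have ut: "t < u" "0 \<le> z u"
    using u gt fl t by (auto simp: less_le fluid_solution_def)
  have "(z has_real_derivative 1 + \<gamma> (z u)) (at u within {0..})"
    using fl ut t by (simp add: fluid_solution_def)
  moreover have "0 < 1 + \<gamma> (z u)"
    using pos[of "z u"] u ut by simp
  ultimately obtain e where e: "e > 0" "\<And>h. h > 0 \<Longrightarrow> u - h \<in> {0..} \<Longrightarrow> h < e \<Longrightarrow> z (u - h) < z u"
    using has_real_derivative_pos_inc_left by metis
  define h where "h = min (e / 2) (u - t)"
  have h: "h > 0" "h < e" "h \<le> u - t"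
    using e ut by (auto simp: h_def)
  then have "z (u - h) < z u"
    using e(2)[of h] t by auto
  then have "u - h \<in> ?A"
    using u h by auto
  then have "u \<le> u - h" by (rule u(2))
  then show False
    using h by simp
qed

text \<open>Up to \<open>T\<close> the path stays in [0, 1], where the speed
  \<open>1 + \<gamma>\<close> is at least 1/2. This converts an error in space into an error in
  time.\<close>

lemma fluid_speed:
  assumes fl: "fluid_solution \<gamma> z" and T: "z T = 1"
    and pos: "\<And>y. 0 \<le> y \<Longrightarrow> y \<le> 1 \<Longrightarrow> -1/2 \<le> \<gamma> y"
    and t: "0 \<le> t" "t \<le> T"
  shows "(T - t) / 2 \<le> 1 - z t"
proof (cases "t = T")
  case False
  then have "t < T" using t by simp
  then obtain x where x: "t < x" "x < T" "z T - z t = (1 + \<gamma> (z x)) * (T - t)"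
    using fluid_MVT[OF fl t(1)] by blast
  have "-1/2 \<le> \<gamma> (z x)"
    using fl fluid_le_one[OF fl T pos, of x] x t by (intro pos) (auto simp: fluid_solution_def)
  then have "(1/2) * (T - t) \<le> (1 + \<gamma> (z x)) * (T - t)"
    using t by (intro mult_right_mono) auto
  then show ?thesis using x T by simp
qed (use T in simp)

lemma fluid_increment:
  assumes fl: "fluid_solution \<gamma> z" and T: "z T = 1"
    and pos: "\<And>y. 0 \<le> y \<Longrightarrow> y \<le> 1 \<Longrightarrow> -1/2 \<le> \<gamma> y"
    and bd: "\<And>y. 0 \<le> y \<Longrightarrow> y \<le> 1 \<Longrightarrow> \<bar>1 + \<gamma> y\<bar> \<le> B"
    and t: "0 \<le> s" "s \<le> t" "t \<le> T"
  shows "\<bar>z t - z s\<bar> \<le> B * (t - s)"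
proof (cases "s = t")
  case False
  then have "s < t" using t by simp
  then obtain x where x: "s < x" "x < t" "z t - z s = (1 + \<gamma> (z x)) * (t - s)"
    using fluid_MVT[OF fl t(1)] by blast
  have "\<bar>1 + \<gamma> (z x)\<bar> \<le> B"
    using fl fluid_le_one[OF fl T pos, of x] x t by (intro bd) (auto simp: fluid_solution_def)
  then show ?thesis using x t by (simp add: abs_mult mult_right_mono)
qed simp

text \<open>By the mean value theorem the true slope is \<open>1 + \<gamma> (z x)\<close> at an
  intermediate \<open>x\<close>. Since \<open>z\<close> moves by at most \<open>B * (t - s)\<close>,
  the Lipschitz bound limits the change of slope. Steps of length 1/N thus cost order 1/N^2 each,
  and N of them order 1/N.\<close>

lemma fluid_Euler_error:
  assumes fl: "fluid_solution \<gamma> z" and T: "z T = 1" and lip: "L-lipschitz_on {0..} \<gamma>"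
    and pos: "\<And>y. 0 \<le> y \<Longrightarrow> y \<le> 1 \<Longrightarrow> -1/2 \<le> \<gamma> y"
    and bd: "\<And>y. 0 \<le> y \<Longrightarrow> y \<le> 1 \<Longrightarrow> \<bar>1 + \<gamma> y\<bar> \<le> B"
    and t: "0 \<le> s" "s \<le> t" "t \<le> T"
  shows "\<bar>z t - z s - (1 + \<gamma> (z s)) * (t - s)\<bar> \<le> L * B * (t - s)\<^sup>2"
proof (cases "s = t")
  case False
  then have "s < t" using t by simp
  then obtain x where x: "s < x" "x < t" "z t - z s = (1 + \<gamma> (z x)) * (t - s)"
    using fluid_MVT[OF fl t(1)] by blast
  have L: "L \<ge> 0" and B: "B \<ge> 0"
    using lip bd[of 0] by (auto simp: lipschitz_on_def)
  have "\<bar>\<gamma> (z x) - \<gamma> (z s)\<bar> \<le> L * \<bar>z x - z s\<bar>"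
    using lipschitz_onD[OF lip, of "z x" "z s"] fl x t by (auto simp: fluid_solution_def dist_real_def)
  also have "\<dots> \<le> L * (B * (x - s))"
    using fluid_increment[OF fl T pos bd, of s x] L x t by (intro mult_left_mono) auto
  also have "\<dots> \<le> L * (B * (t - s))"
    using L B x by (intro mult_left_mono) auto
  finally have "\<bar>\<gamma> (z x) - \<gamma> (z s)\<bar> * (t - s) \<le> L * (B * (t - s)) * (t - s)"
    using t by (intro mult_right_mono) auto
  moreover have "z t - z s - (1 + \<gamma> (z s)) * (t - s) = (\<gamma> (z x) - \<gamma> (z s)) * (t - s)"
    using x by (simp add: algebra_simps)
  ultimately show ?thesis
    using t by (simp add: abs_mult power2_eq_square mult.assoc)
qed simp

subsection \<open>A lower bound for the rate\<close>

text \<open>The support ends at \<open>N - x - 1\<close>, so the sum up to \<open>N - 1\<close>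
  loses no mass.\<close>

lemma nb_mean_eq_expectation:
  assumes "neighbour_laws p" "x < N"
  shows "measure_pmf.expectation (p N x) real = nb_mean p N x"
  unfolding nb_mean_def
  by (rule integral_measure_pmf_real) (use assms in \<open>fastforce simp: neighbour_laws_def\<close>)+

lemma nb_var_eq_expectation:
  assumes "neighbour_laws p" "x < N"
  shows "measure_pmf.expectation (p N x) (\<lambda>k. (real k - nb_mean p N x)\<^sup>2) = nb_var p N x"
  unfolding nb_var_def
  by (rule integral_measure_pmf_real) (use assms in \<open>fastforce simp: neighbour_laws_def\<close>)+

lemma integrable_neighbour_law:
  fixes f :: "nat \<Rightarrow> real"
  assumes "neighbour_laws p" "x < N"
  shows "integrable (p N x) f"
  by (rule integrable_measure_pmf_finite, rule finite_subset[of _ "{0..N - x - 1}"])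
     (use assms in \<open>auto simp: neighbour_laws_def\<close>)

lemma nb_mean_nonneg: "0 \<le> nb_mean p N x"
  by (auto simp: nb_mean_def intro: sum_nonneg)

lemma nb_var_nonneg: "0 \<le> nb_var p N x"
  by (auto simp: nb_var_def intro: sum_nonneg)

lemma nb_var_le_sup: "x < N \<Longrightarrow> nb_var p N x \<le> nb_var_sup p N"
  unfolding nb_var_sup_def by (rule cSUP_upper) auto

lemma nb_var_sup_nonneg: "0 \<le> nb_var_sup p N"
proof -
  have "nb_var p N 0 \<le> nb_var_sup p N"
    unfolding nb_var_sup_def by (rule cSUP_upper) auto
  then show ?thesis using nb_var_nonneg[of p N 0] by simp
qed

text \<open>At \<open>x = N - 1\<close> the support shrinks to 0. This anchors the downward
  induction in \<open>drift_small_on_grid\<close>.\<close>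

lemma nb_mean_last:
  assumes "neighbour_laws p" "N \<ge> 1"
  shows "nb_mean p N (N - 1) = 0"
proof -
  have "set_pmf (p N (N - 1)) \<subseteq> {0}"
    using assms(1)[unfolded neighbour_laws_def, rule_format, of "N - 1" N] assms(2) by simp
  then have "pmf (p N (N - 1)) k = 0" if "k \<noteq> 0" for k
    using that by (meson pmf_eq_0_set_pmf singletonD subsetD)
  then show ?thesis
    by (force simp: nb_mean_def intro!: sum.neutral)
qed

text \<open>An integer-valued random variable whose mean \<open>\<mu>\<close> lies in \<open>[0, 1/2]\<close> stays at distance at
  least \<open>\<mu>\<close> from \<open>\<mu>\<close>.\<close>

lemma nb_mean_squared_le_var:
  assumes p: "neighbour_laws p" "x < N" and "nb_mean p N x \<le> 1/2"
  shows "(nb_mean p N x)\<^sup>2 \<le> nb_var p N x"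
proof -
  let ?m = "nb_mean p N x"
  \<comment> \<open>Equality at \<open>k = 0\<close>; for \<open>k \<ge> 1\<close>,
    \<open>k - ?m \<ge> 1/2 \<ge> ?m\<close>.\<close>
  have "?m\<^sup>2 \<le> (real k - ?m)\<^sup>2" for k :: nat
  proof (cases k)
    case (Suc j)
    then show ?thesis
      using assms nb_mean_nonneg[of p N x] by (intro power_mono) auto
  qed simp
  then have "measure_pmf.expectation (p N x) (\<lambda>_. ?m\<^sup>2)
      \<le> measure_pmf.expectation (p N x) (\<lambda>k. (real k - ?m)\<^sup>2)"
    by (intro integral_mono integrable_neighbour_law p) auto
  then show ?thesis
    using nb_var_eq_expectation[OF p] by simp
qed

lemma grid_point_near:
  assumes "0 \<le> y" "y \<le> 1" "N \<ge> 1"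
  obtains x where "x < N" "\<bar>y - real x / real N\<bar> \<le> 1 / real N"
proof (cases "y = 1")
  case True
  \<comment> \<open>The floor of \<open>y * N\<close> would be \<open>N\<close>, which is not an
    admissible index, hence \<open>N - 1\<close>.\<close>
  show ?thesis
    by (rule that[of "N - 1"]) (use assms True in \<open>auto simp: of_nat_diff field_simps\<close>)
next
  case False
  define x where "x = nat \<lfloor>y * real N\<rfloor>"
  have x: "real x \<le> y * real N" "y * real N < real x + 1"
    using assms by (auto simp: x_def)
  moreover have "y * real N < real N"
    using assms False by simp
  ultimately have "x < N" by linarith
  moreover have "\<bar>y - real x / real N\<bar> \<le> 1 / real N"
  proof -
    have "y - real x / real N = (y * real N - real x) / real N"
      using assms by (simp add: field_simps)
    also have "\<bar>\<dots>\<bar> \<le> 1 / real N"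
      unfolding abs_divide using x by (intro frac_le) (use assms in auto)
    finally show ?thesis .
  qed
  ultimately show ?thesis by (rule that)
qed

lemma drift_near_grid:
  assumes lip: "L-lipschitz_on {0..} \<gamma>" and y: "0 \<le> y" "y \<le> 1" and N: "N \<ge> 1"
  obtains x where "x < N" "\<bar>\<gamma> y - \<gamma> (real x / real N)\<bar> \<le> L / real N"
proof -
  obtain x where x: "x < N" "\<bar>y - real x / real N\<bar> \<le> 1 / real N"
    using grid_point_near[OF y N] .
  have "L \<ge> 0" using lip by (simp add: lipschitz_on_def)
  have "\<bar>\<gamma> y - \<gamma> (real x / real N)\<bar> \<le> L * \<bar>y - real x / real N\<bar>"
    using lipschitz_onD[OF lip, of y "real x / real N"] y by (auto simp: dist_real_def)
  also have "\<dots> \<le> L * (1 / real N)"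
    using x \<open>L \<ge> 0\<close> by (intro mult_left_mono) auto
  finally show ?thesis using that[OF x(1)] by simp
qed

lemma setting_drift_error:
  assumes "exploration_setting p M Z \<gamma> L d z Tstar" "x < N"
  shows "\<bar>nb_mean p N x - \<gamma> (real x / real N)\<bar> \<le> d N"
proof -
  have "\<bar>nb_mean p N x - \<gamma> (real x / real N)\<bar>
      \<le> (SUP x\<in>{0..N - 1}. \<bar>nb_mean p N x - \<gamma> (real x / real N)\<bar>)"
    by (rule cSUP_upper) (use assms(2) in auto)
  also have "\<dots> \<le> d N"
    using assms by (auto simp: exploration_setting_def)
  finally show ?thesis .
qed

text \<open>Since the last selected item has no unexplored neighbour, the drift is close to \<open>0\<close> at
  \<open>1 - 1/N\<close>. Small variance keeps the means close to integers, and the Lipschitz bound prevents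
  them from jumping from \<open>0\<close> to another integer.\<close>

lemma drift_small_on_grid:
  assumes p: "neighbour_laws p" and lip: "L-lipschitz_on {0..} \<gamma>" and N: "N \<ge> 1"
    and dr: "\<And>x. x < N \<Longrightarrow> \<bar>nb_mean p N x - \<gamma> (real x / real N)\<bar> \<le> D"
    and sm: "D + sqrt (nb_var_sup p N) \<le> 1/8" "L / real N \<le> 1/8"
    and x: "x < N"
  shows "\<bar>\<gamma> (real x / real N)\<bar> \<le> D + sqrt (nb_var_sup p N)"
  using x
\<comment> \<open>Downward induction on \<open>x\<close>, starting from the last item.\<close>
proof (induction "N - 1 - x" arbitrary: x)
  case 0
  then have "x = N - 1" by simp
  then have "\<bar>\<gamma> (real x / real N)\<bar> \<le> D"
    using dr[of x] nb_mean_last[OF p N] 0 by simp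
  then show ?case using nb_var_sup_nonneg[of p N] by (meson add_increasing2 order_refl real_sqrt_ge_zero order_trans)
next
  case (Suc n)
  have IH: "\<bar>\<gamma> (real (Suc x) / real N)\<bar> \<le> D + sqrt (nb_var_sup p N)"
    by (rule Suc.hyps) (use Suc in auto)
  have "\<bar>\<gamma> (real (Suc x) / real N) - \<gamma> (real x / real N)\<bar> \<le> L * \<bar>real (Suc x) / real N - real x / real N\<bar>"
    using lipschitz_onD[OF lip, of "real (Suc x) / real N" "real x / real N"] by (auto simp: dist_real_def)
  also have "\<dots> = L / real N"
    using N by (simp add: field_simps)
  \<comment> \<open>1/8 from the induction hypothesis and 1/8 from one Lipschitz step. Adding
    \<open>D \<le> 1/8\<close> keeps the mean below 1/2.\<close>
  finally have "\<bar>\<gamma> (real x / real N)\<bar> \<le> 1/4"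
    using IH sm by linarith
  moreover have "0 \<le> sqrt (nb_var_sup p N)"
    using nb_var_sup_nonneg by simp
  ultimately have "nb_mean p N x \<le> 1/2"
    using dr[OF Suc.prems] sm by linarith
  then have "(nb_mean p N x)\<^sup>2 \<le> nb_var_sup p N"
    using nb_mean_squared_le_var[OF p Suc.prems] nb_var_le_sup[OF Suc.prems, of p] by simp
  then have "nb_mean p N x \<le> sqrt (nb_var_sup p N)"
    by (rule real_le_rsqrt)
  \<comment> \<open>The induction hypothesis served only to bring the mean below 1/2, so the bound
    does not accumulate over the steps.\<close>
  then show ?case
    using dr[OF Suc.prems] nb_mean_nonneg[of p N x] by linarith
qed

lemma omega_rate_ge:
  assumes N: "N \<ge> 1" and "0 \<le> d N" "L \<ge> 0"
  shows "(d N + sqrt (nb_var_sup p N / real N)) * exp L \<le> omega_rate p L d N"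
proof -
  have "sqrt (nb_var_sup p N / real N) \<le> 2 * sqrt (2 * (nb_var_sup p N / real N))"
  proof -
    have "sqrt (nb_var_sup p N / real N) \<le> sqrt (2 * (nb_var_sup p N / real N))"
      using divide_nonneg_nonneg[OF nb_var_sup_nonneg[of p N], of "real N"] by (intro real_sqrt_le_mono) simp
    moreover have "0 \<le> sqrt (2 * (nb_var_sup p N / real N))"
      using nb_var_sup_nonneg[of p N] by simp
    ultimately show ?thesis by linarith
  qed
  then show ?thesis unfolding omega_rate_def by (intro mult_right_mono) auto
qed

lemma omega_rate_ge_drift_error:
  assumes N: "N \<ge> 1" and "0 \<le> d N" "L \<ge> 0"
  shows "d N \<le> omega_rate p L d N"
proof -
  have "d N * 1 \<le> (d N + sqrt (nb_var_sup p N / real N)) * exp L"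
    using assms nb_var_sup_nonneg[of p N] by (intro mult_mono) auto
  then show ?thesis using omega_rate_ge[of N d L p] assms by simp
qed

text \<open>If \<open>d N + sqrt (nb_var_sup p N)\<close> were below a fixed small \<open>c\<close>
  for a large \<open>N\<close>, \<open>drift_small_on_grid\<close> would make \<gamma> too small
  near \<open>y\<close>. Dividing by \<open>sqrt N\<close> turns this into a lower bound for the
  rate, in which the variance is already divided by \<open>N\<close>.\<close>

lemma omega_rate_lower_bound:
  assumes E: "exploration_setting p M Z \<gamma> L d z Tstar"
    and y: "0 \<le> y" "y \<le> 1" "\<gamma> y \<noteq> 0"
  obtains c where "c > 0" "\<forall>\<^sub>F N in sequentially. c / sqrt (real N) \<le> omega_rate p L d N"
proof -
  let ?a = "\<bar>\<gamma> y\<bar>"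
  \<comment> \<open>1/8 is the smallness threshold of \<open>drift_small_on_grid\<close>;
    \<open>?a / 2\<close> leaves room for the grid bound and the Lipschitz error
    \<open>L / N\<close>, each below \<open>c\<close>.\<close>
  define c where "c = min (1/8) (?a / 2)"
  have c: "c > 0" "c \<le> 1/8" "c \<le> ?a / 2" using y by (auto simp: c_def)
  have p: "neighbour_laws p" and lip: "L-lipschitz_on {0..} \<gamma>" and d: "\<And>N. N \<ge> 1 \<Longrightarrow> 0 \<le> d N"
    using E by (auto simp: exploration_setting_def)
  have L: "L \<ge> 0" using lip by (simp add: lipschitz_on_def)
  have "(\<lambda>N. L / real N) \<longlonglongrightarrow> 0"
    by (rule lim_const_over_n)
  then have "\<forall>\<^sub>F N in sequentially. L / real N < c"
    using order_tendstoD(2) c(1) by blast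
  then have "\<forall>\<^sub>F N in sequentially. c / sqrt (real N) \<le> omega_rate p L d N"
    using eventually_ge_at_top[of 1]
  proof eventually_elim
    case (elim N)
    let ?s = "sqrt (nb_var_sup p N)"
    have "c \<le> d N + ?s"
    proof (rule ccontr)
      assume lt: "\<not> c \<le> d N + ?s"
      obtain x where x: "x < N" "\<bar>\<gamma> y - \<gamma> (real x / real N)\<bar> \<le> L / real N"
        using drift_near_grid[OF lip y(1,2)] elim by metis
      have "\<bar>\<gamma> (real x / real N)\<bar> \<le> d N + ?s"
        by (rule drift_small_on_grid[OF p lip _ setting_drift_error[OF E]])
           (use lt c elim x in linarith)+
      then show False using x lt c elim by linarith
    qed
    then have "c / sqrt (real N) \<le> (d N + ?s) / sqrt (real N)"
      by (simp add: divide_right_mono)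
    also have "\<dots> \<le> (d N + sqrt (nb_var_sup p N / real N)) * 1"
    proof -
      have "d N / sqrt (real N) \<le> d N"
        using d[of N] elim by (simp add: divide_le_eq mult_le_cancel_left1)
      then show ?thesis by (simp add: add_divide_distrib real_sqrt_divide)
    qed
    also have "\<dots> \<le> (d N + sqrt (nb_var_sup p N / real N)) * exp L"
      using L d[of N] elim nb_var_sup_nonneg[of p N] by (intro mult_left_mono) auto
    also have "\<dots> \<le> omega_rate p L d N"
      using omega_rate_ge d L elim by blast
    finally show ?case .
  qed
  with c(1) show ?thesis by (rule that)
qed

subsection \<open>Path laws of discrete Markov chains\<close>

text \<open>Newest state first, so that \<open>hd\<close> is the current state and \<open>tl\<close>
  the past.\<close>

primrec history :: "(nat \<Rightarrow> 'a \<Rightarrow> 's) \<Rightarrow> nat \<Rightarrow> 'a \<Rightarrow> 's list" where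
  "history Z 0 \<omega> = [Z 0 \<omega>]"
| "history Z (Suc n) \<omega> = Z (Suc n) \<omega> # history Z n \<omega>"

text \<open>The joint law that the kernel prescribes. It replaces the arbitrary space
  \<open>M\<close> by a pmf, of finite support when the kernel has finite supports.\<close>

primrec history_law :: "('s \<Rightarrow> 's pmf) \<Rightarrow> 's \<Rightarrow> nat \<Rightarrow> 's list pmf" where
  "history_law K s0 0 = return_pmf [s0]"
| "history_law K s0 (Suc n) = bind_pmf (history_law K s0 n) (\<lambda>xs. map_pmf (\<lambda>y. y # xs) (K (hd xs)))"

lemma length_history [simp]: "length (history Z n \<omega>) = Suc n"
  by (induction n) auto

lemma hd_history [simp]: "hd (history Z n \<omega>) = Z n \<omega>"
  by (cases n) auto

lemma history_eq_iff:
  "history Z n \<omega> = xs \<longleftrightarrow> length xs = Suc n \<and> (\<forall>i\<le>n. Z i \<omega> = xs ! (n - i))"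
proof (induction n arbitrary: xs)
  case 0
  then show ?case by (cases xs) auto
next
  case (Suc n)
  show ?case
  proof (cases xs)
    case (Cons y ys)
    have "(\<forall>i\<le>Suc n. Z i \<omega> = xs ! (Suc n - i)) \<longleftrightarrow> Z (Suc n) \<omega> = y \<and> (\<forall>i\<le>n. Z i \<omega> = ys ! (n - i))"
      by (auto simp: le_Suc_eq Cons Suc_diff_le)
    then show ?thesis using Suc[of ys] Cons by auto
  qed simp
qed

lemma markov_chain_measurable:
  fixes Z :: "nat \<Rightarrow> 'a \<Rightarrow> 's::countable"
  assumes "markov_chain_from M Z S K s0"
  shows "Z n \<in> measurable M (count_space UNIV)" "history Z n \<in> measurable M (count_space UNIV)"
proof -
  have Z: "Z n \<in> measurable M (count_space UNIV)" for n
    using measurable_compose[OF _ measurable_count_space, of "Z n" M S id] assms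
    by (auto simp: markov_chain_from_def)
  then show "Z n \<in> measurable M (count_space UNIV)" .
  have [measurable]: "Z n \<in> measurable M (count_space UNIV)" for n by fact
  have "{\<omega> \<in> space M. length xs = Suc n \<and> (\<forall>i\<le>n. Z i \<omega> = xs ! (n - i))} \<in> sets M" for xs
    by measurable
  then have "{\<omega> \<in> space M. history Z n \<omega> = xs} \<in> sets M" for xs
    unfolding history_eq_iff .
  then show "history Z n \<in> measurable M (count_space UNIV)"
    by (subst measurable_count_space_eq2_countable) (auto simp: vimage_def Int_def conj_commute)
qed

lemma length_history_law: "xs \<in> set_pmf (history_law K s0 n) \<Longrightarrow> length xs = Suc n"
  by (induction n arbitrary: xs) auto

lemma pmf_history_law_Suc:
  "pmf (history_law K s0 (Suc n)) (y # ys) = pmf (history_law K s0 n) ys * pmf (K (hd ys)) y"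
proof -
  have "pmf (map_pmf (\<lambda>y. y # xs) q) (y # ys) = indicator {ys} xs * pmf q y" for xs and q :: "'a pmf"
  proof (cases "xs = ys")
    case True
    then show ?thesis using pmf_map_inj'[of "\<lambda>y. y # xs" q y] by (auto simp: inj_on_def)
  next
    case False
    then show ?thesis by (auto simp: pmf_eq_0_set_pmf)
  qed
  then have "pmf (history_law K s0 (Suc n)) (y # ys)
      = (\<integral>xs. indicator {ys} xs * pmf (K (hd ys)) y \<partial>history_law K s0 n)"
    unfolding history_law.simps pmf_bind
    by (intro Bochner_Integration.integral_cong) (auto simp del: indicator_simps split: split_indicator)
  also have "\<dots> = (\<integral>xs. indicator {ys} xs \<partial>history_law K s0 n) * pmf (K (hd ys)) y"
    by simp
  finally show ?thesis by (simp add: measure_pmf_single)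
qed

text \<open>Induction on \<open>n\<close>, multiplying by one conditional probability per step. The
  Markov property speaks only of pasts of positive probability; for the others both sides
  vanish.\<close>

lemma measure_history:
  fixes Z :: "nat \<Rightarrow> 'a \<Rightarrow> 's::countable"
  assumes mc: "markov_chain_from M Z S K s0"
  shows "measure M {\<omega> \<in> space M. history Z n \<omega> = xs} = pmf (history_law K s0 n) xs"
proof (induction n arbitrary: xs)
  case 0
  interpret prob_space M using mc by (simp add: markov_chain_from_def)
  have [measurable]: "Z 0 \<in> measurable M (count_space UNIV)"
    using markov_chain_measurable(1)[OF mc] .
  have ae: "AE \<omega> in M. Z 0 \<omega> = s0"
    using mc by (simp add: markov_chain_from_def)
  show ?case
  proof (cases "xs = [s0]")
    case True
    have "measure M {\<omega> \<in> space M. Z 0 \<omega> = s0} = 1"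
      using ae by (intro prob_Collect_eq_1[THEN iffD2]) auto
    then show ?thesis using True by simp
  next
    case False
    have "measure M {\<omega> \<in> space M. [Z 0 \<omega>] = xs} = 0"
      using ae False by (intro prob_Collect_eq_0[THEN iffD2]) (auto elim!: eventually_mono)
    then show ?thesis using False by simp
  qed
next
  case (Suc n)
  interpret prob_space M using mc by (simp add: markov_chain_from_def)
  show ?case
  proof (cases xs)
    case Nil
    then show ?thesis
      using length_history_law[of "[]" K s0 "Suc n"] by (auto simp: pmf_eq_0_set_pmf simp del: history_law.simps)
  next
    case (Cons y ys)
    show ?thesis
    proof (cases "measure M {\<omega> \<in> space M. history Z n \<omega> = ys} > 0")
      case True
      then have len: "length ys = Suc n"
        using Suc[of ys] length_history_law[of ys K s0 n] by (auto simp: pmf_positive_iff)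
      \<comment> \<open>Reverses the newest-first list into a path indexed by time.\<close>
      define path where "path i = ys ! (n - i)" for i
      have h: "history Z n \<omega> = ys \<longleftrightarrow> (\<forall>i\<le>n. Z i \<omega> = path i)" for \<omega>
        using len by (auto simp: history_eq_iff path_def)
      have hd: "path n = hd ys"
        using len by (cases ys) (auto simp: path_def)
      have "cond_prob M (\<lambda>\<omega>. Z (Suc n) \<omega> = y) (\<lambda>\<omega>. history Z n \<omega> = ys) = pmf (K (hd ys)) y"
        using mc True unfolding markov_chain_from_def h hd[symmetric] by blast
      then have "measure M {\<omega> \<in> space M. Z (Suc n) \<omega> = y \<and> history Z n \<omega> = ys}
          = pmf (K (hd ys)) y * measure M {\<omega> \<in> space M. history Z n \<omega> = ys}"
        using True by (simp add: cond_prob_def field_simps)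
      then show ?thesis using Cons by (simp add: pmf_history_law_Suc Suc del: history_law.simps)
    next
      case False
      have [measurable]: "history Z n \<in> measurable M (count_space UNIV)"
        using markov_chain_measurable(2)[OF mc] .
      have zero: "measure M {\<omega> \<in> space M. history Z n \<omega> = ys} = 0"
        using False measure_nonneg[of M] by (simp add: less_le)
      have "measure M {\<omega> \<in> space M. history Z (Suc n) \<omega> = xs} \<le> measure M {\<omega> \<in> space M. history Z n \<omega> = ys}"
        by (rule finite_measure_mono) (auto simp: Cons)
      then have "measure M {\<omega> \<in> space M. history Z (Suc n) \<omega> = xs} = 0"
        using zero measure_nonneg[of M] by (metis antisym)
      moreover have "pmf (history_law K s0 n) ys = 0"
        using zero Suc by simp
      ultimately show ?thesis by (simp add: Cons pmf_history_law_Suc del: history_law.simps history.simps)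
    qed
  qed
qed

lemma distr_history:
  fixes Z :: "nat \<Rightarrow> 'a \<Rightarrow> 's::countable"
  assumes mc: "markov_chain_from M Z S K s0"
  shows "distr M (count_space UNIV) (history Z n) = measure_pmf (history_law K s0 n)"
proof (rule measure_eqI_countable_AE[where \<Omega> = UNIV])
  interpret prob_space M using mc by (simp add: markov_chain_from_def)
  fix xs
  show "emeasure (distr M (count_space UNIV) (history Z n)) {xs} = emeasure (measure_pmf (history_law K s0 n)) {xs}"
    using markov_chain_measurable(2)[OF mc, of n] measure_history[OF mc, of n xs]
    by (simp add: emeasure_distr emeasure_eq_measure vimage_def Int_def conj_commute emeasure_pmf_single)
qed auto

lemma expectation_history:
  fixes Z :: "nat \<Rightarrow> 'a \<Rightarrow> 's::countable" and f :: "'s list \<Rightarrow> real"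
  assumes mc: "markov_chain_from M Z S K s0"
  shows "(\<integral>\<omega>. f (history Z n \<omega>) \<partial>M) = measure_pmf.expectation (history_law K s0 n) f"
  using markov_chain_measurable(2)[OF mc, of n]
  by (simp add: distr_history[OF mc, symmetric] integral_distr)

lemma integrable_history:
  fixes Z :: "nat \<Rightarrow> 'a \<Rightarrow> 's::countable" and f :: "'s list \<Rightarrow> real"
  assumes mc: "markov_chain_from M Z S K s0" and "integrable (history_law K s0 n) f"
  shows "integrable M (\<lambda>\<omega>. f (history Z n \<omega>))"
  using markov_chain_measurable(2)[OF mc, of n] assms(2)
  by (simp add: distr_history[OF mc, symmetric] integrable_distr_eq)

lemma AE_history:
  fixes Z :: "nat \<Rightarrow> 'a \<Rightarrow> 's::countable"
  assumes mc: "markov_chain_from M Z S K s0"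
  shows "AE \<omega> in M. history Z n \<omega> \<in> set_pmf (history_law K s0 n)"
proof -
  have "AE xs in distr M (count_space UNIV) (history Z n). xs \<in> set_pmf (history_law K s0 n)"
    unfolding distr_history[OF mc] by (rule AE_pmfI)
  then show ?thesis
    using markov_chain_measurable(2)[OF mc, of n] by (subst (asm) AE_distr_iff) auto
qed

text \<open>Countably many almost sure events hold simultaneously, so later arguments can run along
  a single path.\<close>

lemma AE_markov_chain_step:
  fixes Z :: "nat \<Rightarrow> 'a \<Rightarrow> 's::countable"
  assumes mc: "markov_chain_from M Z S K s0"
  shows "AE \<omega> in M. Z 0 \<omega> = s0 \<and> (\<forall>n. Z (Suc n) \<omega> \<in> set_pmf (K (Z n \<omega>)))"
proof -
  have "AE \<omega> in M. \<forall>n. history Z (Suc n) \<omega> \<in> set_pmf (history_law K s0 (Suc n))"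
    using AE_history[OF mc] by (subst AE_all_countable) (auto simp del: history_law.simps history.simps)
  moreover have "AE \<omega> in M. Z 0 \<omega> = s0"
    using mc by (simp add: markov_chain_from_def)
  ultimately show ?thesis
    by eventually_elim (auto simp: set_eq_iff)
qed

lemma finite_set_history_law:
  assumes "\<And>x. finite (set_pmf (K x))"
  shows "finite (set_pmf (history_law K s0 n))"
  by (induction n) (auto simp: assms)

text \<open>The tower property, conditioning on the first \<open>n\<close> steps; finite supports
  make all expectations finite sums.\<close>

lemma expectation_history_law_Suc:
  fixes f :: "'s list \<Rightarrow> real"
  assumes fin: "\<And>x. finite (set_pmf (K x))"
  shows "measure_pmf.expectation (history_law K s0 (Suc n)) f
    = measure_pmf.expectation (history_law K s0 n) (\<lambda>xs. measure_pmf.expectation (K (hd xs)) (\<lambda>y. f (y # xs)))"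
proof -
  have "measure_pmf.expectation (history_law K s0 (Suc n)) f
    = (\<Sum>xs\<in>set_pmf (history_law K s0 n). pmf (history_law K s0 n) xs *\<^sub>R
        measure_pmf.expectation (map_pmf (\<lambda>y. y # xs) (K (hd xs))) f)"
    unfolding history_law.simps
    by (rule pmf_expectation_bind) (auto simp: fin finite_set_history_law[OF fin])
  also have "\<dots> = measure_pmf.expectation (history_law K s0 n) (\<lambda>xs. measure_pmf.expectation (K (hd xs)) (\<lambda>y. f (y # xs)))"
    by (subst integral_measure_pmf[of "set_pmf (history_law K s0 n)"]) (auto simp: finite_set_history_law[OF fin])
  finally show ?thesis .
qed

subsection \<open>The stopped error\<close>

text \<open>Every state below \<open>N\<close> is followed by the activation of one item, so over
  the past states this is a clock that stops at absorption and can be read off the history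
  alone.\<close>

definition active_count :: "nat \<Rightarrow> nat list \<Rightarrow> nat" where
  "active_count N xs = length (filter (\<lambda>x. x < N) xs)"

text \<open>Along a history of \<open>n\<close> steps the count below equals \<open>min n (final_time N Z \<omega>)\<close>, so this is
  the deviation from the fluid limit, frozen at absorption.\<close>

definition stopped_error :: "nat \<Rightarrow> (real \<Rightarrow> real) \<Rightarrow> nat list \<Rightarrow> real" where
  "stopped_error N z xs = real (hd xs) / real N - z (real (active_count N (tl xs)) / real N)"

lemma set_step_law:
  assumes "neighbour_laws p" "y \<in> set_pmf (step_law p N x)"
  shows "x < N \<Longrightarrow> x < y \<and> y \<le> N" "\<not> x < N \<Longrightarrow> y = N"
  using assms by (force simp: step_law_def neighbour_laws_def)+

lemma finite_step_law:
  assumes "neighbour_laws p"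
  shows "finite (set_pmf (step_law p N x))"
  by (rule finite_subset[of _ "{..N}"]) (use set_step_law[OF assms] in force)+

lemma exploration_history:
  assumes p: "neighbour_laws p" and "xs \<in> set_pmf (history_law (step_law p N) 0 n)"
  shows "length xs = Suc n \<and> hd xs \<le> N \<and> (hd xs < N \<longrightarrow> (\<forall>x\<in>set xs. x < N))"
  using assms(2)
proof (induction n arbitrary: xs)
  case (Suc n)
  then obtain ys y where xs: "xs = y # ys" "ys \<in> set_pmf (history_law (step_law p N) 0 n)"
      "y \<in> set_pmf (step_law p N (hd ys))"
    by auto
  then show ?case
    using Suc.IH[OF xs(2)] set_step_law[OF p xs(3)] by (cases "hd ys < N") auto
qed simp

text \<open>Before absorption the next error is \<open>b + (real k - ?m) / real N\<close> with
  \<open>b\<close> fixed by the past. The second summand is centred, so the cross term vanishes and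
  the second moment is \<open>b\<^sup>2\<close> plus the variance over N^2.\<close>

lemma stopped_error_step:
  assumes p: "neighbour_laws p" and N: "N \<ge> 1" and lip: "L-lipschitz_on {0..} \<gamma>" and D: "0 \<le> D"
    and dr: "\<And>x. x < N \<Longrightarrow> \<bar>nb_mean p N x - \<gamma> (real x / real N)\<bar> \<le> D"
    and z: "0 \<le> z (real n / real N)"
    and eu: "\<bar>z (real (Suc n) / real N) - z (real n / real N) - (1 + \<gamma> (z (real n / real N))) / real N\<bar>
      \<le> \<kappa> / (real N)\<^sup>2"
    and xs: "xs \<in> set_pmf (history_law (step_law p N) 0 n)"
  shows "measure_pmf.expectation (step_law p N (hd xs)) (\<lambda>y. (stopped_error N z (y # xs))\<^sup>2)
    \<le> ((1 + L / real N) * \<bar>stopped_error N z xs\<bar> + (D + \<kappa> / real N) / real N)\<^sup>2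
      + nb_var_sup p N / (real N)\<^sup>2"
proof -
  let ?e = "stopped_error N z xs" and ?x = "hd xs"
  have L: "L \<ge> 0" using lip by (simp add: lipschitz_on_def)
  have "0 \<le> \<kappa> / (real N)\<^sup>2" using eu by linarith
  then have \<kappa>: "0 \<le> \<kappa>" using N by (simp add: zero_le_divide_iff)
  have h: "length xs = Suc n" "?x \<le> N" "?x < N \<Longrightarrow> \<forall>x\<in>set xs. x < N"
    using exploration_history[OF p xs] by auto
  then obtain ys where ys: "xs = ?x # ys" by (cases xs) auto
  show ?thesis
  proof (cases "?x < N")
    case False
    \<comment> \<open>Here the current state is \<open>N\<close>, which the clock does not count:
      state and clock are both frozen.\<close>
    then have "active_count N xs = active_count N (tl xs)"
      using ys by (cases xs) (auto simp: active_count_def)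
    then have "measure_pmf.expectation (step_law p N ?x) (\<lambda>y. (stopped_error N z (y # xs))\<^sup>2) = \<bar>?e\<bar>\<^sup>2"
      using False h by (simp add: step_law_def stopped_error_def)
    also have "\<dots> \<le> ((1 + L / real N) * \<bar>?e\<bar> + (D + \<kappa> / real N) / real N)\<^sup>2"
      using L D \<kappa> by (intro power_mono) (auto intro!: add_increasing2 simp: algebra_simps)
    finally show ?thesis
      using divide_nonneg_nonneg[OF nb_var_sup_nonneg[of p N] zero_le_power2[of "real N"]] by linarith
  next
    case True
    have cnt: "active_count N xs = Suc n" "active_count N (tl xs) = n"
    proof -
      have "filter (\<lambda>x. x < N) xs = xs"
        using h True by (simp add: filter_id_conv)
      moreover have "filter (\<lambda>x. x < N) (tl xs) = tl xs"
        using h True ys by (cases xs) (auto simp: filter_id_conv)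
      ultimately show "active_count N xs = Suc n" "active_count N (tl xs) = n"
        using h by (simp_all add: active_count_def)
    qed
    let ?m = "nb_mean p N ?x"
    define b where "b = ?e + (1 + ?m) / real N - (z (real (Suc n) / real N) - z (real n / real N))"
    have err: "stopped_error N z ((?x + k + 1) # xs) = b + (real k - ?m) / real N" for k
      by (simp add: stopped_error_def cnt b_def add_divide_distrib diff_divide_distrib)
    \<comment> \<open>Old error, drift error, Lipschitz term and Euler error, in this order.\<close>
    have "b = ?e + (?m - \<gamma> (real ?x / real N)) / real N
        + (\<gamma> (real ?x / real N) - \<gamma> (z (real n / real N))) / real N
        - (z (real (Suc n) / real N) - z (real n / real N) - (1 + \<gamma> (z (real n / real N))) / real N)"
      by (simp add: b_def add_divide_distrib diff_divide_distrib)
    then have "\<bar>b\<bar> \<le> \<bar>?e\<bar> + \<bar>(?m - \<gamma> (real ?x / real N)) / real N\<bar>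
        + \<bar>(\<gamma> (real ?x / real N) - \<gamma> (z (real n / real N))) / real N\<bar> + \<kappa> / (real N)\<^sup>2"
      using eu by linarith
    also have "\<bar>(?m - \<gamma> (real ?x / real N)) / real N\<bar> \<le> D / real N"
      using dr[OF True] by (simp add: divide_right_mono)
    also have "\<bar>(\<gamma> (real ?x / real N) - \<gamma> (z (real n / real N))) / real N\<bar> \<le> L * \<bar>?e\<bar> / real N"
      using lipschitz_onD[OF lip, of "real ?x / real N" "z (real n / real N)"] z
      by (simp add: divide_right_mono dist_real_def stopped_error_def cnt)
    finally have b: "\<bar>b\<bar> \<le> (1 + L / real N) * \<bar>?e\<bar> + (D + \<kappa> / real N) / real N"
      by (simp add: algebra_simps add_divide_distrib power2_eq_square)
    have "measure_pmf.expectation (step_law p N ?x) (\<lambda>y. (stopped_error N z (y # xs))\<^sup>2)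
        = measure_pmf.expectation (p N ?x) (\<lambda>k. (b + (real k - ?m) / real N)\<^sup>2)"
      using True err by (simp add: step_law_def)
    also have "\<dots> = measure_pmf.expectation (p N ?x)
        (\<lambda>k. (b\<^sup>2 - 2 * b / real N * ?m) + 2 * b / real N * real k + (real k - ?m)\<^sup>2 / (real N)\<^sup>2)"
      using N by (intro Bochner_Integration.integral_cong) (auto simp: field_simps power2_eq_square)
    also have "\<dots> = (b\<^sup>2 - 2 * b / real N * ?m)
        + 2 * b / real N * measure_pmf.expectation (p N ?x) real
        + measure_pmf.expectation (p N ?x) (\<lambda>k. (real k - ?m)\<^sup>2) / (real N)\<^sup>2"
      by (subst Bochner_Integration.integral_add
          | rule integrable_neighbour_law[OF p True] | simp)+
    also have "\<dots> = b\<^sup>2 + nb_var p N ?x / (real N)\<^sup>2"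
      by (simp add: nb_mean_eq_expectation[OF p True] nb_var_eq_expectation[OF p True])
    also have "\<dots> \<le> ((1 + L / real N) * \<bar>?e\<bar> + (D + \<kappa> / real N) / real N)\<^sup>2
        + nb_var_sup p N / (real N)\<^sup>2"
      using power_mono[OF b abs_ge_zero, of 2] nb_var_le_sup[OF True, of p]
      by (intro add_mono) (auto simp: divide_right_mono)
    finally show ?thesis .
  qed
qed

text \<open>Minkowski's inequality with a constant. After expanding the square only the mean of
  \<open>\<bar>X\<bar>\<close> remains, which is at most \<open>s\<close> because the variance of
  \<open>\<bar>X\<bar>\<close> is nonnegative.\<close>

lemma (in prob_space) expectation_affine_square_le:
  fixes X :: "'a \<Rightarrow> real"
  assumes X: "integrable M X" "integrable M (\<lambda>x. (X x)\<^sup>2)"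
    and bd: "expectation (\<lambda>x. (X x)\<^sup>2) \<le> s\<^sup>2" and s: "0 \<le> s" and ab: "0 \<le> a" "0 \<le> b"
  shows "integrable M (\<lambda>x. (a * \<bar>X x\<bar> + b)\<^sup>2)"
    and "expectation (\<lambda>x. (a * \<bar>X x\<bar> + b)\<^sup>2) \<le> (a * s + b)\<^sup>2"
proof -
  have eq: "(a * \<bar>X x\<bar> + b)\<^sup>2 = a\<^sup>2 * (X x)\<^sup>2 + 2 * a * b * \<bar>X x\<bar> + b\<^sup>2" for x
    by (simp add: power2_sum power_mult_distrib)
  show "integrable M (\<lambda>x. (a * \<bar>X x\<bar> + b)\<^sup>2)"
    unfolding eq using X by auto
  have "(expectation (\<lambda>x. \<bar>X x\<bar>))\<^sup>2 \<le> expectation (\<lambda>x. (X x)\<^sup>2)"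
    using variance_eq[of "\<lambda>x. \<bar>X x\<bar>"] variance_positive[of "\<lambda>x. \<bar>X x\<bar>"] X by simp
  then have E: "expectation (\<lambda>x. \<bar>X x\<bar>) \<le> s"
    using bd s by (meson order_trans power2_le_imp_le)
  have "expectation (\<lambda>x. (a * \<bar>X x\<bar> + b)\<^sup>2)
      = a\<^sup>2 * expectation (\<lambda>x. (X x)\<^sup>2) + 2 * a * b * expectation (\<lambda>x. \<bar>X x\<bar>) + b\<^sup>2"
    unfolding eq using X by (simp add: prob_space)
  also have "\<dots> \<le> a\<^sup>2 * s\<^sup>2 + 2 * a * b * s + b\<^sup>2"
    using bd E ab by (intro add_mono mult_left_mono) auto
  also have "\<dots> = (a * s + b)\<^sup>2"
    by (simp add: power2_sum power_mult_distrib)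
  finally show "expectation (\<lambda>x. (a * \<bar>X x\<bar> + b)\<^sup>2) \<le> (a * s + b)\<^sup>2" .
qed

text \<open>Drift errors add linearly and centred noise in quadrature, hence \<open>n * D\<close>
  and \<open>sqrt n * c\<close>. With \<open>A\<close> the drift part and \<open>B\<close>,
  \<open>B'\<close> the noise parts, \<open>B\<^sup>2 + c\<^sup>2 \<le> B'\<^sup>2\<close> and
  \<open>A * B \<le> A * B'\<close> give the claim.\<close>

lemma discrete_Gronwall_step:
  fixes q D c :: real
  assumes q: "1 \<le> q" and D: "0 \<le> D" and c: "0 \<le> c"
  shows "(q * (q ^ n * (real n * D + sqrt (real n) * c)) + D)\<^sup>2 + c\<^sup>2
    \<le> (q ^ Suc n * (real (Suc n) * D + sqrt (real (Suc n)) * c))\<^sup>2"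
proof -
  let ?Q = "q ^ Suc n"
  have Q: "1 \<le> ?Q" using q by (rule one_le_power)
  define A B B' where "A = ?Q * (real (Suc n) * D)" and "B = ?Q * (sqrt (real n) * c)"
    and "B' = ?Q * (sqrt (real (Suc n)) * c)"
  have nn: "0 \<le> A" "0 \<le> B" and BB: "B \<le> B'"
    using Q D c by (auto simp: A_def B_def B'_def intro!: mult_left_mono mult_right_mono)
  have "D * 1 \<le> D * ?Q" using Q D by (intro mult_left_mono)
  then have "q * (q ^ n * (real n * D + sqrt (real n) * c)) + D \<le> A + B"
    by (simp add: A_def B_def algebra_simps)
  then have "(q * (q ^ n * (real n * D + sqrt (real n) * c)) + D)\<^sup>2 \<le> (A + B)\<^sup>2"
    using q D c by (intro power_mono) auto
  moreover have "B\<^sup>2 + c\<^sup>2 \<le> B'\<^sup>2"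
  proof -
    have "1 * c\<^sup>2 \<le> ?Q\<^sup>2 * c\<^sup>2"
      by (intro mult_right_mono one_le_power[OF Q]) auto
    then show ?thesis
      by (simp add: B_def B'_def power_mult_distrib algebra_simps del: power_Suc)
  qed
  moreover have "A * B \<le> A * B'"
    using nn BB by (intro mult_left_mono)
  moreover have "?Q * (real (Suc n) * D + sqrt (real (Suc n)) * c) = A + B'"
    by (simp add: A_def B'_def algebra_simps)
  ultimately show ?thesis
    by (simp add: power2_sum del: power_Suc)
qed

text \<open>Over at most \<open>N\<close> steps the factors \<open>1 + L / N\<close> multiply to at
  most \<open>exp L\<close>, the drift and Euler errors add up to at most
  \<open>D + \<kappa> / N\<close>, and the noise, adding in quadrature, to at most
  \<open>sqrt (nb_var_sup p N / N)\<close>.\<close>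

lemma expectation_stopped_error:
  assumes p: "neighbour_laws p" and N: "N \<ge> 1" and lip: "L-lipschitz_on {0..} \<gamma>" and D: "0 \<le> D"
    and dr: "\<And>x. x < N \<Longrightarrow> \<bar>nb_mean p N x - \<gamma> (real x / real N)\<bar> \<le> D"
    and z: "z 0 = 0" "\<And>t. 0 \<le> t \<Longrightarrow> 0 \<le> z t" and \<kappa>: "0 \<le> \<kappa>"
    and eu: "\<And>n. n < m \<Longrightarrow>
      \<bar>z (real (Suc n) / real N) - z (real n / real N) - (1 + \<gamma> (z (real n / real N))) / real N\<bar>
      \<le> \<kappa> / (real N)\<^sup>2"
    and m: "m \<le> N"
  shows "measure_pmf.expectation (history_law (step_law p N) 0 m) (\<lambda>xs. (stopped_error N z xs)\<^sup>2)
    \<le> ((D + \<kappa> / real N + sqrt (nb_var_sup p N / real N)) * exp L)\<^sup>2"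
proof -
  define q D' c where "q = 1 + L / real N" and "D' = (D + \<kappa> / real N) / real N"
    and "c = sqrt (nb_var_sup p N) / real N"
  have L: "L \<ge> 0" using lip by (simp add: lipschitz_on_def)
  have pos: "1 \<le> q" "0 \<le> D'" "0 \<le> c"
    using L D \<kappa> nb_var_sup_nonneg[of p N] by (auto simp: q_def D'_def c_def)
  have c2: "c\<^sup>2 = nb_var_sup p N / (real N)\<^sup>2"
    using nb_var_sup_nonneg[of p N] by (simp add: c_def power_divide)
  let ?h = "history_law (step_law p N) 0"
  have fin: "finite (set_pmf (?h n))" for n
    by (rule finite_set_history_law) (rule finite_step_law[OF p])
  have int: "integrable (?h n) f" for n and f :: "nat list \<Rightarrow> real"
    by (rule integrable_measure_pmf_finite[OF fin])
  have "measure_pmf.expectation (?h n) (\<lambda>xs. (stopped_error N z xs)\<^sup>2)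
      \<le> (q ^ n * (real n * D' + sqrt (real n) * c))\<^sup>2" if "n \<le> m" for n
    using that
  proof (induction n)
    case 0
    then show ?case by (simp add: stopped_error_def active_count_def z)
  next
    case (Suc n)
    let ?s = "q ^ n * (real n * D' + sqrt (real n) * c)"
    have "measure_pmf.expectation (?h (Suc n)) (\<lambda>xs. (stopped_error N z xs)\<^sup>2)
        = measure_pmf.expectation (?h n) (\<lambda>xs. measure_pmf.expectation (step_law p N (hd xs))
            (\<lambda>y. (stopped_error N z (y # xs))\<^sup>2))"
      by (rule expectation_history_law_Suc) (rule finite_step_law[OF p])
    also have "\<dots> \<le> measure_pmf.expectation (?h n) (\<lambda>xs. (q * \<bar>stopped_error N z xs\<bar> + D')\<^sup>2 + c\<^sup>2)"
    proof (rule integral_mono_AE[OF int int AE_pmfI])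
      fix xs assume "xs \<in> set_pmf (?h n)"
      then show "measure_pmf.expectation (step_law p N (hd xs)) (\<lambda>y. (stopped_error N z (y # xs))\<^sup>2)
          \<le> (q * \<bar>stopped_error N z xs\<bar> + D')\<^sup>2 + c\<^sup>2"
        unfolding q_def D'_def c2
        by (intro stopped_error_step[OF p N lip D dr _ eu]) (use Suc z in auto)
    qed
    also have "\<dots> = measure_pmf.expectation (?h n) (\<lambda>xs. (q * \<bar>stopped_error N z xs\<bar> + D')\<^sup>2) + c\<^sup>2"
      by (subst Bochner_Integration.integral_add[OF int int]) simp
    also have "\<dots> \<le> (q * ?s + D')\<^sup>2 + c\<^sup>2"
      using measure_pmf.expectation_affine_square_le(2)[OF int int Suc.IH, of q D'] Suc.prems pos by simp
    also have "\<dots> \<le> (q ^ Suc n * (real (Suc n) * D' + sqrt (real (Suc n)) * c))\<^sup>2"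
      by (rule discrete_Gronwall_step[OF pos])
    finally show ?case .
  qed
  then have "measure_pmf.expectation (?h m) (\<lambda>xs. (stopped_error N z xs)\<^sup>2)
      \<le> (q ^ m * (real m * D' + sqrt (real m) * c))\<^sup>2"
    by simp
  also have "\<dots> \<le> ((D + \<kappa> / real N + sqrt (nb_var_sup p N / real N)) * exp L)\<^sup>2"
  proof (rule power_mono)
    have "q ^ m \<le> exp (L / real N) ^ m"
      using pos by (intro power_mono) (auto simp: q_def exp_ge_add_one_self)
    also have "\<dots> = exp (real m * (L / real N))"
      by (rule exp_of_nat_mult[symmetric])
    also have "\<dots> \<le> exp L"
      using m L N by (simp add: field_simps mult_left_mono)
    finally have Q: "q ^ m \<le> exp L" .
    have "real m * D' \<le> real N * D'"
      using m pos by (intro mult_right_mono) auto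
    also have "\<dots> = D + \<kappa> / real N"
      using N by (simp add: D'_def)
    finally have 1: "real m * D' \<le> D + \<kappa> / real N" .
    have "sqrt (real m) * c \<le> sqrt (real N) * c"
      using m pos by (intro mult_right_mono) auto
    also have "\<dots> = sqrt (nb_var_sup p N / real N)"
      using N by (simp add: c_def real_sqrt_divide real_div_sqrt field_simps)
    finally have 2: "sqrt (real m) * c \<le> sqrt (nb_var_sup p N / real N)" .
    show "q ^ m * (real m * D' + sqrt (real m) * c)
        \<le> (D + \<kappa> / real N + sqrt (nb_var_sup p N / real N)) * exp L"
      using mult_mono[OF Q add_mono[OF 1 2]] pos by (simp add: mult.commute)
  qed (use pos in auto)
  finally show ?thesis .
qed

section \<open>Pathwise comparison of the time error with the stopped error\<close>

lemma exploration_path: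
  assumes p: "neighbour_laws p" and N: "N \<ge> 1" and Z0: "Z 0 \<omega> = 0"
    and step: "\<And>n. Z (Suc n) \<omega> \<in> set_pmf (step_law p N (Z n \<omega>))"
  shows "final_time N Z \<omega> \<le> N"
    and "n < final_time N Z \<omega> \<Longrightarrow> Z n \<omega> < N"
    and "final_time N Z \<omega> \<le> n \<Longrightarrow> Z n \<omega> = N"
    and "n \<le> final_time N Z \<omega> \<Longrightarrow> Z n \<omega> + (final_time N Z \<omega> - n) \<le> N"
    and "active_count N (tl (history Z n \<omega>)) = min n (final_time N Z \<omega>)"
proof -
  note incr = set_step_law[OF p step]
  let ?T = "final_time N Z \<omega>" and ?A = "{\<tau>. 1 \<le> \<tau> \<and> Z \<tau> \<omega> = N}"
  have le: "Z n \<omega> \<le> N" for n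
    using incr Z0 by (cases n; force)
  \<comment> \<open>Each step gains at least one item, so \<open>N\<close> is reached by time
    \<open>N\<close>; the set in \<open>final_time\<close> is nonempty and its infimum is
    attained.\<close>
  have "min n N \<le> Z n \<omega>" for n
  proof (induction n)
    case (Suc n)
    then show ?case using incr[of n] by (cases "Z n \<omega> < N") auto
  qed simp
  then have "Z N \<omega> = N"
    using le[of N] by (metis antisym min.idem)
  then have "N \<in> ?A" using N by simp
  then show T: "?T \<le> N"
    unfolding final_time_def by (intro wellorder_Inf_le1)
  have TA: "?T \<in> ?A"
    unfolding final_time_def using \<open>N \<in> ?A\<close> by (intro Inf_nat_def1) auto
  show lt: "Z n \<omega> < N" if "n < ?T" for n
  \<comment> \<open>Time 0 is separate because \<open>final_time\<close> ranges over positive times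
    only.\<close>
  proof (cases "n = 0")
    case False
    then have "n \<notin> ?A"
      using that wellorder_Inf_le1[of n ?A] by (auto simp: final_time_def)
    then show ?thesis using le[of n] False by simp
  qed (use Z0 N in simp)
  show eq: "Z n \<omega> = N" if "?T \<le> n" for n
    using that by (induction n rule: dec_induct) (use TA incr in auto)
  \<comment> \<open>Backwards from the absorption time, losing at least one item per step.\<close>
  show "Z n \<omega> + (?T - n) \<le> N" if "n \<le> ?T" for n
    using that
  proof (induction rule: inc_induct)
    case (step n)
    have "Z n \<omega> < Z (Suc n) \<omega>"
      using incr(1)[OF lt] step.hyps by blast
    then show ?case using step.IH step.hyps by linarith
  qed (use TA in simp)
  have "active_count N (history Z n \<omega>) = min (Suc n) ?T" for n
  proof (induction n)
    case 0
    then show ?case using TA Z0 N by (simp add: active_count_def)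
  next
    case (Suc n)
    then show ?case using lt[of "Suc n"] eq[of "Suc n"]
      by (cases "Suc n < ?T") (auto simp: active_count_def)
  qed
  then show "active_count N (tl (history Z n \<omega>)) = min n ?T"
    by (cases n) (auto simp: active_count_def)
qed

text \<open>If absorption happens before \<open>m\<close>, the frozen error is \<open>1 - z (\<tau> / N)\<close>, which controls
  \<open>Tstar - \<tau> / N\<close> as \<open>z\<close> has speed at least \<open>1/2\<close>; otherwise at most \<open>N - Z m \<omega>\<close> steps remain.\<close>

lemma time_error_le_stopped_error:
  assumes p: "neighbour_laws p" and N: "N \<ge> 1" and Z0: "Z N 0 \<omega> = 0"
    and step: "\<And>n. Z N (Suc n) \<omega> \<in> set_pmf (step_law p N (Z N n \<omega>))"
    and speed: "\<And>t. 0 \<le> t \<Longrightarrow> t \<le> Tstar \<Longrightarrow> (Tstar - t) / 2 \<le> 1 - z t"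
    and m: "m \<le> N" "real m / real N \<le> Tstar"
      "m < N \<Longrightarrow> Tstar < real (Suc m) / real N" "m < N \<Longrightarrow> 1 - z (real m / real N) \<le> r"
    and r: "0 \<le> r"
  shows "\<bar>time_error N Z Tstar \<omega>\<bar> \<le> 2 * \<bar>stopped_error N z (history (Z N) m \<omega>)\<bar> + r"
proof -
  note path = exploration_path[where Z = "Z N" and \<omega> = \<omega>, OF p N Z0 step]
  let ?T = "final_time N (Z N) \<omega>" and ?e = "stopped_error N z (history (Z N) m \<omega>)"
  have e: "?e = real (Z N m \<omega>) / real N - z (real (min m ?T) / real N)"
    by (simp add: stopped_error_def path(5))
  show ?thesis
  proof (cases "?T \<le> m")
    case True
    then have "real ?T / real N \<le> real m / real N"
      by (simp add: divide_right_mono)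
    then have T: "real ?T / real N \<le> Tstar" using m by linarith
    have "?e = 1 - z (real ?T / real N)"
      using e path(3)[OF True] True N by (simp add: min_def)
    then have "(Tstar - real ?T / real N) / 2 \<le> ?e"
      using speed[of "real ?T / real N"] T by simp
    then show ?thesis using T r by (simp add: time_error_def)
  next
    case False
    then have mN: "m < N" using path(1) by simp
    have "real (Suc m) / real N \<le> real ?T / real N"
      using False by (intro divide_right_mono) auto
    then have T: "Tstar < real ?T / real N" using m(3)[OF mN] by linarith
    have "real (Z N m \<omega>) + real ?T \<le> real N + real m"
      using path(4)[of m] False by linarith
    then have "(real (Z N m \<omega>) + real ?T) / real N \<le> (real N + real m) / real N"
      by (intro divide_right_mono) auto
    then have "real (Z N m \<omega>) / real N + real ?T / real N \<le> 1 + real m / real N"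
      using N by (simp add: add_divide_distrib)
    moreover have "?e = real (Z N m \<omega>) / real N - z (real m / real N)"
      using e False by (simp add: min_def)
    \<comment> \<open>The overshoot \<open>?T / N - Tstar\<close> is positive and, as
      \<open>m / N \<le> Tstar\<close>, at most
      \<open>1 - z (m / N) - ?e \<le> r + \<bar>?e\<bar>\<close>.\<close>
    ultimately show ?thesis
      using T m(2) m(4)[OF mN] unfolding time_error_def by linarith
  qed
qed

subsection \<open>The time error\<close>

lemma measurable_final_time:
  assumes [measurable]: "\<And>n. Z n \<in> measurable M (count_space UNIV)"
  shows "final_time N Z \<in> measurable M (count_space UNIV)"
  unfolding final_time_def[abs_def] Inf_nat_def mem_Collect_eq by measurable

lemma exploration_setting_chain:
  assumes "exploration_setting p M Z \<gamma> L d z Tstar" "N \<ge> 1"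
  shows "markov_chain_from (M N) (Z N) {0..N} (step_law p N) 0" "prob_space (M N)"
    and "time_error N Z Tstar \<in> borel_measurable (M N)"
    and "AE \<omega> in M N. \<bar>time_error N Z Tstar \<omega>\<bar> \<le> 1 + Tstar"
proof -
  show mc: "markov_chain_from (M N) (Z N) {0..N} (step_law p N) 0"
    using assms by (simp add: exploration_setting_def exploration_chain_def)
  then show "prob_space (M N)"
    by (simp add: markov_chain_from_def)
  have "final_time N (Z N) \<in> measurable (M N) (count_space UNIV)"
    by (rule measurable_final_time) (rule markov_chain_measurable(1)[OF mc])
  then show "time_error N Z Tstar \<in> borel_measurable (M N)"
    unfolding time_error_def[abs_def] by measurable
  show "AE \<omega> in M N. \<bar>time_error N Z Tstar \<omega>\<bar> \<le> 1 + Tstar"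
    using AE_markov_chain_step[OF mc]
  proof eventually_elim
    case (elim \<omega>)
    have "final_time N (Z N) \<omega> \<le> N"
      using assms elim by (intro exploration_path(1)[of p]) (auto simp: exploration_setting_def)
    then have "real (final_time N (Z N) \<omega>) / real N \<le> 1"
      using assms(2) by simp
    moreover have "0 \<le> real (final_time N (Z N) \<omega>) / real N" "0 \<le> Tstar"
      using assms(1) by (auto simp: exploration_setting_def)
    ultimately show ?case
      unfolding time_error_def by linarith
  qed
qed

text \<open>Combines the pathwise comparison with the moment bound. The discretisation errors
  \<kappa> and \<open>r\<close> remain parameters, since both are 0 for zero drift.\<close>

lemma time_error_second_moment:
  assumes E: "exploration_setting p M Z \<gamma> L d z Tstar" and N: "N \<ge> 1"
    and speed: "\<And>t. 0 \<le> t \<Longrightarrow> t \<le> Tstar \<Longrightarrow> (Tstar - t) / 2 \<le> 1 - z t"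
    and m: "m \<le> N" "real m / real N \<le> Tstar"
      "m < N \<Longrightarrow> Tstar < real (Suc m) / real N" "m < N \<Longrightarrow> 1 - z (real m / real N) \<le> r"
    and r: "0 \<le> r" and \<kappa>: "0 \<le> \<kappa>"
    and eu: "\<And>n. n < m \<Longrightarrow>
      \<bar>z (real (Suc n) / real N) - z (real n / real N) - (1 + \<gamma> (z (real n / real N))) / real N\<bar>
      \<le> \<kappa> / (real N)\<^sup>2"
  shows "integrable (M N) (\<lambda>\<omega>. (time_error N Z Tstar \<omega>)\<^sup>2)"
    and "(\<integral>\<omega>. (time_error N Z Tstar \<omega>)\<^sup>2 \<partial>M N)
      \<le> (2 * omega_rate p L d N + (2 * \<kappa> * exp L / real N + r))\<^sup>2"
proof -
  note ch = exploration_setting_chain[OF E N]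
  interpret prob_space "M N" by (rule ch(2))
  have p: "neighbour_laws p" and lip: "L-lipschitz_on {0..} \<gamma>" and d: "0 \<le> d N"
    and z: "z 0 = 0" "\<And>t. 0 \<le> t \<Longrightarrow> 0 \<le> z t"
    using E N by (auto simp: exploration_setting_def fluid_solution_def)
  let ?s = "(d N + \<kappa> / real N + sqrt (nb_var_sup p N / real N)) * exp L"
  let ?e = "\<lambda>\<omega>. stopped_error N z (history (Z N) m \<omega>)"
  have s: "0 \<le> ?s"
    using d \<kappa> nb_var_sup_nonneg[of p N] by simp
  have int: "integrable (M N) (\<lambda>\<omega>. f (history (Z N) m \<omega>))" for f :: "nat list \<Rightarrow> real"
    by (rule integrable_history[OF ch(1)])
       (intro integrable_measure_pmf_finite finite_set_history_law finite_step_law p)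
  have "(\<integral>\<omega>. (?e \<omega>)\<^sup>2 \<partial>M N) \<le> ?s\<^sup>2"
    using expectation_history[OF ch(1), of "\<lambda>xs. (stopped_error N z xs)\<^sup>2" m]
      expectation_stopped_error[OF p N lip d setting_drift_error[OF E] z \<kappa> eu m(1)] by simp
  note aff = expectation_affine_square_le[OF int int this s, of 2 r]
  have L: "L \<ge> 0" using lip by (simp add: lipschitz_on_def)
  have ae: "AE \<omega> in M N. (time_error N Z Tstar \<omega>)\<^sup>2 \<le> (2 * \<bar>?e \<omega>\<bar> + r)\<^sup>2"
    using AE_markov_chain_step[OF ch(1)]
  proof eventually_elim
    case (elim \<omega>)
    have "\<bar>time_error N Z Tstar \<omega>\<bar> \<le> 2 * \<bar>?e \<omega>\<bar> + r"
      by (rule time_error_le_stopped_error[OF p N _ _ speed m r]) (use elim in auto)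
    then show ?case
      using power_mono[of "\<bar>time_error N Z Tstar \<omega>\<bar>" _ 2] by simp
  qed
  have mb [measurable]: "time_error N Z Tstar \<in> borel_measurable (M N)"
    by (rule ch(3))
  show i: "integrable (M N) (\<lambda>\<omega>. (time_error N Z Tstar \<omega>)\<^sup>2)"
    using aff(1) r ae by (rule_tac Bochner_Integration.integrable_bound) auto
  have "(\<integral>\<omega>. (time_error N Z Tstar \<omega>)\<^sup>2 \<partial>M N) \<le> (\<integral>\<omega>. (2 * \<bar>?e \<omega>\<bar> + r)\<^sup>2 \<partial>M N)"
    using aff(1) r ae by (intro integral_mono_AE i) auto
  also have "\<dots> \<le> (2 * ?s + r)\<^sup>2"
    using aff(2) r by simp
  also have "\<dots> \<le> (2 * omega_rate p L d N + (2 * \<kappa> * exp L / real N + r))\<^sup>2"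
  proof (rule power_mono)
    have "?s \<le> omega_rate p L d N + \<kappa> * exp L / real N"
      using omega_rate_ge[of N d L p] N d L by (simp add: algebra_simps)
    then show "2 * ?s + r \<le> 2 * omega_rate p L d N + (2 * \<kappa> * exp L / real N + r)"
      by simp
    show "0 \<le> 2 * ?s + r" using s r by linarith
  qed
  finally show "(\<integral>\<omega>. (time_error N Z Tstar \<omega>)\<^sup>2 \<partial>M N)
      \<le> (2 * omega_rate p L d N + (2 * \<kappa> * exp L / real N + r))\<^sup>2" .
qed

section \<open>Second moment of the time error in terms of the rate\<close>

text \<open>Means are nonnegative, so \<gamma> is at least \<open>- d N\<close> on the grid, and
  moving off the grid costs at most \<open>L / N\<close>.\<close>

lemma drift_lower_bound:
  assumes E: "exploration_setting p M Z \<gamma> L d z Tstar" and N: "N \<ge> 1"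
    and sm: "d N \<le> 1/4" "L / real N \<le> 1/4" and y: "0 \<le> y" "y \<le> 1"
  shows "-1/2 \<le> \<gamma> y"
proof -
  have lip: "L-lipschitz_on {0..} \<gamma>" using E by (simp add: exploration_setting_def)
  obtain x where x: "x < N" "\<bar>\<gamma> y - \<gamma> (real x / real N)\<bar> \<le> L / real N"
    using drift_near_grid[OF lip y N] .
  then show ?thesis
    using setting_drift_error[OF E x(1)] nb_mean_nonneg[of p N x] sm by linarith
qed

text \<open>With zero drift the Euler scheme is exact and \<open>Tstar = 1\<close>, so there is no discretisation error.\<close>

lemma second_moment_bound_driftless:
  assumes E: "exploration_setting p M Z \<gamma> L d z Tstar"
    and \<gamma>: "\<And>y. 0 \<le> y \<Longrightarrow> y \<le> 1 \<Longrightarrow> \<gamma> y = 0" and N: "N \<ge> 1"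
  shows "integrable (M N) (\<lambda>\<omega>. (time_error N Z Tstar \<omega>)\<^sup>2)"
    and "(\<integral>\<omega>. (time_error N Z Tstar \<omega>)\<^sup>2 \<partial>M N) \<le> (2 * omega_rate p L d N)\<^sup>2"
proof -
  have fl: "fluid_solution \<gamma> z" and T: "z Tstar = 1" "0 \<le> Tstar"
    using E by (auto simp: exploration_setting_def)
  have z: "z t = t" if "0 \<le> t" "t \<le> Tstar" for t
  proof (cases "t = 0")
    case False
    then have "0 < t" using that by simp
    then obtain x where x: "0 < x" "x < t" "z t - z 0 = (1 + \<gamma> (z x)) * (t - 0)"
      using fluid_MVT[OF fl order_refl] by metis
    have "z x \<le> 1"
      by (rule fluid_le_one[OF fl T(1)]) (use \<gamma> x that in auto)
    then have "\<gamma> (z x) = 0"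
      using fl x by (intro \<gamma>) (auto simp: fluid_solution_def)
    then show ?thesis using x fl by (simp add: fluid_solution_def)
  qed (use fl in \<open>simp add: fluid_solution_def\<close>)
  then have T1: "Tstar = 1" using T by force
  have eu: "\<bar>z (real (Suc n) / real N) - z (real n / real N) - (1 + \<gamma> (z (real n / real N))) / real N\<bar>
      \<le> 0 / (real N)\<^sup>2" if "n < N" for n
  proof -
    have "real (Suc n) / real N \<le> 1" "real n / real N \<le> 1"
      using that by auto
    then show ?thesis using z T1 \<gamma> by (simp add: add_divide_distrib)
  qed
  have sp: "(Tstar - t) / 2 \<le> 1 - z t" if "0 \<le> t" "t \<le> Tstar" for t
    using z T1 that by simp
  \<comment> \<open>As \<open>Tstar = 1\<close>, the time \<open>m = N\<close> is exact and the
    conditions for \<open>m < N\<close> are vacuous.\<close>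
  note sm = time_error_second_moment[OF E N sp, of N 0 0, OF _ _ _ _ _ _ _ _ eu]
  show "integrable (M N) (\<lambda>\<omega>. (time_error N Z Tstar \<omega>)\<^sup>2)"
    by (rule sm(1)) (use N T1 in auto)
  have "(\<integral>\<omega>. (time_error N Z Tstar \<omega>)\<^sup>2 \<partial>M N)
      \<le> (2 * omega_rate p L d N + (2 * 0 * exp L / real N + 0))\<^sup>2"
    by (rule sm(2)) (use N T1 in auto)
  then show "(\<integral>\<omega>. (time_error N Z Tstar \<omega>)\<^sup>2 \<partial>M N) \<le> (2 * omega_rate p L d N)\<^sup>2" by simp
qed

lemma second_moment_bound:
  assumes E: "exploration_setting p M Z \<gamma> L d z Tstar"
    and pos: "\<And>y. 0 \<le> y \<Longrightarrow> y \<le> 1 \<Longrightarrow> -1/2 \<le> \<gamma> y"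
    and bd: "\<And>y. 0 \<le> y \<Longrightarrow> y \<le> 1 \<Longrightarrow> \<bar>1 + \<gamma> y\<bar> \<le> B" and N: "N \<ge> 1"
  shows "integrable (M N) (\<lambda>\<omega>. (time_error N Z Tstar \<omega>)\<^sup>2)"
    and "(\<integral>\<omega>. (time_error N Z Tstar \<omega>)\<^sup>2 \<partial>M N)
      \<le> (2 * omega_rate p L d N + (2 * L * B * exp L + B) / real N)\<^sup>2"
proof -
  have fl: "fluid_solution \<gamma> z" and T: "z Tstar = 1" "0 \<le> Tstar" and lip: "L-lipschitz_on {0..} \<gamma>"
    using E by (auto simp: exploration_setting_def)
  have L: "L \<ge> 0" using lip by (simp add: lipschitz_on_def)
  have B: "B \<ge> 0" using bd[of 0] by simp
  \<comment> \<open>The last grid index before \<open>Tstar\<close>, capped at \<open>N\<close>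
    because the moment bound covers at most \<open>N\<close> steps. Without the cap taking effect,
    less than one grid step remains, whence \<open>r = B / N\<close>; the Euler error gives
    \<open>\<kappa> = L * B\<close>.\<close>
  define m where "m = min N (nat \<lfloor>Tstar * real N\<rfloor>)"
  have m: "m \<le> N" by (simp add: m_def)
  have "real m \<le> Tstar * real N"
  proof -
    have "real m \<le> real (nat \<lfloor>Tstar * real N\<rfloor>)" by (simp add: m_def)
    also have "\<dots> \<le> Tstar * real N" using T by (intro of_nat_floor) simp
    finally show ?thesis .
  qed
  then have mT: "real m / real N \<le> Tstar"
    using N by (simp add: field_simps)
  have mS: "Tstar < real (Suc m) / real N" if "m < N"
  proof -
    have "Tstar * real N < real (Suc m)"
      using that T by (simp add: m_def min_def split: if_splits) linarith
    then show ?thesis using N by (simp add: field_simps)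
  qed
  have mz: "1 - z (real m / real N) \<le> B / real N" if "m < N"
  proof -
    have "1 - z (real m / real N) \<le> B * (Tstar - real m / real N)"
      using fluid_increment[OF fl T(1) pos bd, of "real m / real N" Tstar] mT T by simp
    also have "\<dots> \<le> B * (1 / real N)"
      using mS[OF that] B by (intro mult_left_mono) (auto simp: add_divide_distrib)
    finally show ?thesis by simp
  qed
  have eu: "\<bar>z (real (Suc n) / real N) - z (real n / real N) - (1 + \<gamma> (z (real n / real N))) / real N\<bar>
      \<le> (L * B) / (real N)\<^sup>2" if "n < m" for n
  proof -
    have "real (Suc n) / real N \<le> real m / real N"
      using that by (intro divide_right_mono) auto
    then have "real (Suc n) / real N \<le> Tstar" using mT by linarith
    moreover have "real (Suc n) / real N - real n / real N = 1 / real N"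
      by (simp add: add_divide_distrib)
    ultimately show ?thesis
      using fluid_Euler_error[OF fl T(1) lip pos bd, of "real n / real N" "real (Suc n) / real N"]
      by (simp add: divide_right_mono power_divide)
  qed
  have sp: "(Tstar - t) / 2 \<le> 1 - z t" if "0 \<le> t" "t \<le> Tstar" for t
    by (rule fluid_speed[OF fl T(1) pos that])
  have "0 \<le> B / real N" "0 \<le> L * B" using L B by auto
  note sm = time_error_second_moment[OF E N sp m mT mS mz this eu]
  show "integrable (M N) (\<lambda>\<omega>. (time_error N Z Tstar \<omega>)\<^sup>2)"
    by (rule sm(1))
  show "(\<integral>\<omega>. (time_error N Z Tstar \<omega>)\<^sup>2 \<partial>M N)
      \<le> (2 * omega_rate p L d N + (2 * L * B * exp L + B) / real N)\<^sup>2"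
    using sm(2) by (simp add: add_divide_distrib mult.assoc)
qed

lemma omega_rate_nonneg:
  assumes "exploration_setting p M Z \<gamma> L d z Tstar" "N \<ge> 1"
  shows "0 \<le> omega_rate p L d N"
  using assms nb_var_sup_nonneg[of p N] by (auto simp: omega_rate_def exploration_setting_def)

text \<open>The factor 3 is the 2 of the pathwise comparison plus 1 that absorbs the discretisation
  term \<open>K / N\<close>.\<close>

lemma eventually_second_moment_bound:
  assumes E: "exploration_setting p M Z \<gamma> L d z Tstar"
    and pos: "\<And>y. 0 \<le> y \<Longrightarrow> y \<le> 1 \<Longrightarrow> -1/2 \<le> \<gamma> y"
  shows "\<forall>\<^sub>F N in sequentially. integrable (M N) (\<lambda>\<omega>. (time_error N Z Tstar \<omega>)\<^sup>2) \<and>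
    (\<integral>\<omega>. (time_error N Z Tstar \<omega>)\<^sup>2 \<partial>M N) \<le> (3 * omega_rate p L d N)\<^sup>2"
proof (cases "\<forall>y. 0 \<le> y \<longrightarrow> y \<le> 1 \<longrightarrow> \<gamma> y = 0")
  case True
  show ?thesis
    using eventually_ge_at_top[of 1]
  proof eventually_elim
    case (elim N)
    have le: "(2 * omega_rate p L d N)\<^sup>2 \<le> (3 * omega_rate p L d N)\<^sup>2"
      using omega_rate_nonneg[OF E elim] by (intro power_mono) auto
    have "\<And>y. 0 \<le> y \<Longrightarrow> y \<le> 1 \<Longrightarrow> \<gamma> y = 0" using True by blast
    note b = second_moment_bound_driftless[OF E this elim]
    show ?case by (rule conjI[OF b(1) order_trans[OF b(2) le]])
  qed
next
  case False
  then obtain c where c: "c > 0" "\<forall>\<^sub>F N in sequentially. c / sqrt (real N) \<le> omega_rate p L d N"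
    using omega_rate_lower_bound[OF E] by metis
  have lip: "L-lipschitz_on {0..} \<gamma>" using E by (simp add: exploration_setting_def)
  define B where "B = 1 + \<bar>\<gamma> 0\<bar> + L"
  have bd: "\<bar>1 + \<gamma> y\<bar> \<le> B" if "0 \<le> y" "y \<le> 1" for y
  proof -
    have "\<bar>\<gamma> y - \<gamma> 0\<bar> \<le> L * \<bar>y\<bar>"
      using lipschitz_onD[OF lip, of y 0] that by (simp add: dist_real_def)
    also have "\<dots> \<le> L * 1"
      using lip that by (intro mult_left_mono) (auto simp: lipschitz_on_def)
    finally show ?thesis unfolding B_def by linarith
  qed
  define K where "K = 2 * L * B * exp L + B"
  have K: "0 \<le> K"
    using lip by (auto simp: K_def B_def lipschitz_on_def)
  have "(\<lambda>N. K / sqrt (real N)) \<longlonglongrightarrow> 0"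
    by real_asymp
  then have "\<forall>\<^sub>F N in sequentially. K / sqrt (real N) < c"
    using order_tendstoD(2) c(1) by blast
  then show ?thesis
    using c(2) eventually_ge_at_top[of 1]
  proof eventually_elim
    case (elim N)
    \<comment> \<open>One factor brings \<open>K / sqrt N\<close> below \<open>c\<close>; the other
      leaves the lower bound \<open>c / sqrt N\<close> of the rate.\<close>
    have "K / real N = K / sqrt (real N) / sqrt (real N)"
      by simp
    also have "\<dots> \<le> c / sqrt (real N)"
      using elim by (intro divide_right_mono) auto
    finally have "2 * omega_rate p L d N + K / real N \<le> 3 * omega_rate p L d N"
      using elim by simp
    then have "(2 * omega_rate p L d N + K / real N)\<^sup>2 \<le> (3 * omega_rate p L d N)\<^sup>2"
      using K omega_rate_nonneg[OF E elim(3)] by (intro power_mono) auto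
    then show ?case
      using second_moment_bound[OF E pos bd elim(3)] by (simp add: K_def)
  qed
qed

text \<open>If \<gamma> falls below -1/2 somewhere on [0, 1], \<open>drift_lower_bound\<close>
  forces \<open>d N > 1/4\<close> for all large \<open>N\<close>, and the rate dominates
  \<open>d N\<close>.\<close>

lemma eventually_dichotomy:
  assumes E: "exploration_setting p M Z \<gamma> L d z Tstar"
  shows "\<forall>\<^sub>F N in sequentially. 1/4 \<le> omega_rate p L d N \<or>
    integrable (M N) (\<lambda>\<omega>. (time_error N Z Tstar \<omega>)\<^sup>2) \<and>
    (\<integral>\<omega>. (time_error N Z Tstar \<omega>)\<^sup>2 \<partial>M N) \<le> (3 * omega_rate p L d N)\<^sup>2"
proof (cases "\<forall>y. 0 \<le> y \<longrightarrow> y \<le> 1 \<longrightarrow> -1/2 \<le> \<gamma> y")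
  case True
  then have "\<forall>\<^sub>F N in sequentially. integrable (M N) (\<lambda>\<omega>. (time_error N Z Tstar \<omega>)\<^sup>2) \<and>
      (\<integral>\<omega>. (time_error N Z Tstar \<omega>)\<^sup>2 \<partial>M N) \<le> (3 * omega_rate p L d N)\<^sup>2"
    by (intro eventually_second_moment_bound[OF E]) blast
  then show ?thesis
    by (rule eventually_mono) (rule disjI2)
next
  case False
  have L: "L \<ge> 0" using E by (simp add: exploration_setting_def lipschitz_on_def)
  have "(\<lambda>N. L / real N) \<longlonglongrightarrow> 0"
    by (rule lim_const_over_n)
  then have "\<forall>\<^sub>F N in sequentially. L / real N < 1/4"
    by (rule order_tendstoD(2)) simp
  then show ?thesis
    using eventually_ge_at_top[of 1]
  proof eventually_elim
    case (elim N)
    have "\<not> d N \<le> 1/4"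
      using False drift_lower_bound[OF E elim(2)] elim(1) by (meson less_imp_le)
    moreover have "d N \<le> omega_rate p L d N"
      using E elim(2) L by (intro omega_rate_ge_drift_error) (auto simp: exploration_setting_def)
    ultimately show ?case by simp
  qed
qed

section \<open>Deviation and norm bounds, and constants uniform in N\<close>

lemma L2_norm_rv_le:
  assumes "integrable M (\<lambda>x. (X x)\<^sup>2)" "(\<integral>x. (X x)\<^sup>2 \<partial>M) \<le> w\<^sup>2" "0 \<le> w"
  shows "L2_norm_rv M X \<le> w"
  using assms by (simp add: L2_norm_rv_def real_le_lsqrt)

text \<open>Valid for every \<open>N\<close>, since absorption occurs by time \<open>N\<close>. It
  serves when the rate is at least 1/4 and for the finitely many \<open>N\<close> that an eventual
  bound leaves out.\<close>

lemma time_error_crude: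
  assumes E: "exploration_setting p M Z \<gamma> L d z Tstar" and N: "N \<ge> 1"
  shows "integrable (M N) (\<lambda>\<omega>. (time_error N Z Tstar \<omega>)\<^sup>2)"
    and "L2_norm_rv (M N) (time_error N Z Tstar) \<le> 1 + Tstar"
proof -
  note ch = exploration_setting_chain[OF E N]
  interpret prob_space "M N" by (rule ch(2))
  have T: "0 \<le> Tstar" using E by (simp add: exploration_setting_def)
  have [measurable]: "time_error N Z Tstar \<in> borel_measurable (M N)"
    by (rule ch(3))
  have ae: "AE \<omega> in M N. (time_error N Z Tstar \<omega>)\<^sup>2 \<le> (1 + Tstar)\<^sup>2"
    using ch(4)
  proof eventually_elim
    case (elim \<omega>)
    then show ?case using power_mono[OF elim abs_ge_zero, of 2] by simp
  qed
  then show i: "integrable (M N) (\<lambda>\<omega>. (time_error N Z Tstar \<omega>)\<^sup>2)"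
    by (intro integrable_const_bound[where B = "(1 + Tstar)\<^sup>2"]) auto
  have "(\<integral>\<omega>. (time_error N Z Tstar \<omega>)\<^sup>2 \<partial>M N) \<le> (1 + Tstar)\<^sup>2"
    by (rule integral_le_const[OF i ae])
  then show "L2_norm_rv (M N) (time_error N Z Tstar) \<le> 1 + Tstar"
    using T by (intro L2_norm_rv_le i) auto
qed

lemma uniform_constant:
  fixes f w :: "nat \<Rightarrow> real"
  assumes ev: "\<forall>\<^sub>F N in sequentially. f N \<le> C0 * w N" and B: "\<And>N. N \<ge> 1 \<Longrightarrow> f N \<le> B"
  obtains C where "C \<ge> C0" "\<And>N. N \<ge> 1 \<Longrightarrow> w N > 0 \<Longrightarrow> f N \<le> C * w N"
proof -
  obtain N0 where N0: "\<And>N. N \<ge> N0 \<Longrightarrow> f N \<le> C0 * w N"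
    using ev by (auto simp: eventually_sequentially)
  \<comment> \<open>Pays for the finitely many early \<open>N\<close>. Where \<open>w N = 0\<close>
    the quotient is 0 by convention, and nothing is claimed there.\<close>
  define S where "S = (\<Sum>N<N0. \<bar>B\<bar> / \<bar>w N\<bar>)"
  have S: "0 \<le> S" by (auto simp: S_def intro: sum_nonneg)
  show ?thesis
  proof (rule that[of "\<bar>C0\<bar> + S"])
    fix N :: nat assume N: "N \<ge> 1" "w N > 0"
    show "f N \<le> (\<bar>C0\<bar> + S) * w N"
    proof (cases "N < N0")
      case True
      then have "\<bar>B\<bar> / \<bar>w N\<bar> \<le> S"
        unfolding S_def by (intro member_le_sum[where f = "\<lambda>N. \<bar>B\<bar> / \<bar>w N\<bar>"]) auto
      then have "\<bar>B\<bar> / w N * w N \<le> (\<bar>C0\<bar> + S) * w N"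
        using N by (intro mult_right_mono) auto
      then show ?thesis using B[OF N(1)] N by simp
    next
      case False
      then have "f N \<le> C0 * w N" using N0 by simp
      also have "\<dots> \<le> (\<bar>C0\<bar> + S) * w N"
        using S N by (intro mult_right_mono) auto
      finally show ?thesis .
    qed
  qed (use S in auto)
qed

text \<open>The summands 4 and \<open>3 / \<delta>\<close> serve the two cases of the dichotomy, so
  the constant depends on \<delta> alone.\<close>

lemma eventually_deviation_bound:
  assumes E: "exploration_setting p M Z \<gamma> L d z Tstar" and \<delta>: "\<delta> > 0"
  shows "\<forall>\<^sub>F N in sequentially.
    measure (M N) {\<omega> \<in> space (M N). \<bar>time_error N Z Tstar \<omega>\<bar> \<ge> \<delta>} \<le> (4 + 3 / \<delta>) * omega_rate p L d N"
  using eventually_dichotomy[OF E] eventually_ge_at_top[of 1]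
proof eventually_elim
  case (elim N)
  note ch = exploration_setting_chain[OF E elim(2)]
  interpret prob_space "M N" by (rule ch(2))
  let ?P = "measure (M N) {\<omega> \<in> space (M N). \<bar>time_error N Z Tstar \<omega>\<bar> \<ge> \<delta>}" and ?w = "omega_rate p L d N"
  have w: "0 \<le> ?w" by (rule omega_rate_nonneg[OF E elim(2)])
  from elim(1) have "?P \<le> 4 * ?w \<or> ?P \<le> 3 / \<delta> * ?w"
  proof
    assume "1/4 \<le> ?w"
    moreover have "?P \<le> 1" by (rule prob_le_1)
    ultimately have "?P \<le> 4 * ?w" by linarith
    then show ?thesis ..
  next
    assume int: "integrable (M N) (\<lambda>\<omega>. (time_error N Z Tstar \<omega>)\<^sup>2) \<and>
      (\<integral>\<omega>. (time_error N Z Tstar \<omega>)\<^sup>2 \<partial>M N) \<le> (3 * ?w)\<^sup>2"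
    let ?u = "3 * ?w / \<delta>"
    have "?P \<le> (\<integral>\<omega>. (time_error N Z Tstar \<omega>)\<^sup>2 \<partial>M N) / \<delta>\<^sup>2"
      using second_moment_method[OF ch(3) _ \<delta>] int by simp
    also have "\<dots> \<le> (3 * ?w)\<^sup>2 / \<delta>\<^sup>2"
      using int by (intro divide_right_mono) auto
    finally have "?P \<le> ?u\<^sup>2"
      by (simp add: power_divide)
    moreover have "?P \<le> 1" by (rule prob_le_1)
    \<comment> \<open>Chebyshev's bound is quadratic in \<open>?u\<close>. It is at most
      \<open>?u\<close> when \<open>?u \<le> 1\<close>; otherwise the trivial bound 1 is.\<close>
    moreover have "?u\<^sup>2 \<le> ?u \<or> 1 \<le> ?u"
      using w \<delta> mult_left_le[of ?u ?u] by (cases "?u \<le> 1") (auto simp: power2_eq_square)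
    ultimately have "?P \<le> ?u" by linarith
    then show ?thesis by simp
  qed
  moreover have "0 \<le> 3 / \<delta> * ?w" using w \<delta> by simp
  ultimately show ?case
    using w by (auto simp: distrib_right)
qed

text \<open>A rate of at least 1/4 turns the crude bound \<open>1 + Tstar\<close> into
  \<open>4 * (1 + Tstar)\<close> times the rate; the other case needs only 3.\<close>

lemma eventually_L2_bound:
  assumes E: "exploration_setting p M Z \<gamma> L d z Tstar"
  shows "\<forall>\<^sub>F N in sequentially. L2_norm_rv (M N) (time_error N Z Tstar)
    \<le> (3 + 4 * (1 + Tstar)) * omega_rate p L d N"
  using eventually_dichotomy[OF E] eventually_ge_at_top[of 1]
proof eventually_elim
  case (elim N)
  let ?w = "omega_rate p L d N"
  have w: "0 \<le> ?w" by (rule omega_rate_nonneg[OF E elim(2)])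
  have T: "0 \<le> Tstar" using E by (simp add: exploration_setting_def)
  from elim(1) have "L2_norm_rv (M N) (time_error N Z Tstar) \<le> (1 + Tstar) * (4 * ?w) \<or>
    L2_norm_rv (M N) (time_error N Z Tstar) \<le> 3 * ?w"
  proof
    assume "1/4 \<le> ?w"
    then have "(1 + Tstar) * 1 \<le> (1 + Tstar) * (4 * ?w)"
      using T by (intro mult_left_mono) auto
    then show ?thesis using time_error_crude(2)[OF E elim(2)] by auto
  qed (use w in \<open>auto intro: L2_norm_rv_le\<close>)
  moreover have "0 \<le> (1 + Tstar) * (4 * ?w)" using w T by simp
  moreover have "(3 + 4 * (1 + Tstar)) * ?w = 3 * ?w + (1 + Tstar) * (4 * ?w)"
    by (simp add: algebra_simps)
  ultimately show ?case
    using w by auto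
qed

theorem proposition2p9:
  shows
    "(\<forall>\<delta>>0. \<exists>C\<^sub>\<delta>::real.
       \<forall>p (M :: nat \<Rightarrow> 'a measure) Z \<gamma> C\<^sub>L d z Tstar.
         exploration_setting p M Z \<gamma> C\<^sub>L d z Tstar \<longrightarrow>
           (\<forall>\<^sub>F N in sequentially.
              measure (M N) {\<omega> \<in> space (M N). \<bar>time_error N Z Tstar \<omega>\<bar> \<ge> \<delta>}
                \<le> C\<^sub>\<delta> * omega_rate p C\<^sub>L d N) \<and>
           (\<exists>C::real. \<forall>N\<ge>1. omega_rate p C\<^sub>L d N > 0 \<longrightarrow>
              measure (M N) {\<omega> \<in> space (M N). \<bar>time_error N Z Tstar \<omega>\<bar> \<ge> \<delta>}
                \<le> C * omega_rate p C\<^sub>L d N)) \<and>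
     (\<forall>p (M :: nat \<Rightarrow> 'a measure) Z \<gamma> C\<^sub>L d z Tstar.
       exploration_setting p M Z \<gamma> C\<^sub>L d z Tstar \<longrightarrow>
       (\<exists>\<epsilon>>0. \<exists>c\<^sub>1>0. \<forall>s\<ge>c\<^sub>1. \<gamma> (z s) \<le> 1 - \<epsilon>) \<longrightarrow>
       (\<exists>C::real.
          (\<forall>\<^sub>F N in sequentially.
             integrable (M N) (\<lambda>\<omega>. \<bar>time_error N Z Tstar \<omega>\<bar>\<^sup>2) \<and>
             L2_norm_rv (M N) (time_error N Z Tstar) \<le> C * omega_rate p C\<^sub>L d N) \<and>
          (\<forall>N\<ge>1. omega_rate p C\<^sub>L d N > 0 \<longrightarrow>
             integrable (M N) (\<lambda>\<omega>. \<bar>time_error N Z Tstar \<omega>\<bar>\<^sup>2) \<and>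
             L2_norm_rv (M N) (time_error N Z Tstar) \<le> C * omega_rate p C\<^sub>L d N)))"
proof (intro conjI allI impI)
  fix \<delta> :: real assume \<delta>: "\<delta> > 0"
  show "\<exists>C\<^sub>\<delta>::real.
       \<forall>p (M :: nat \<Rightarrow> 'a measure) Z \<gamma> C\<^sub>L d z Tstar.
         exploration_setting p M Z \<gamma> C\<^sub>L d z Tstar \<longrightarrow>
           (\<forall>\<^sub>F N in sequentially.
              measure (M N) {\<omega> \<in> space (M N). \<bar>time_error N Z Tstar \<omega>\<bar> \<ge> \<delta>}
                \<le> C\<^sub>\<delta> * omega_rate p C\<^sub>L d N) \<and>
           (\<exists>C::real. \<forall>N\<ge>1. omega_rate p C\<^sub>L d N > 0 \<longrightarrow>
              measure (M N) {\<omega> \<in> space (M N). \<bar>time_error N Z Tstar \<omega>\<bar> \<ge> \<delta>}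
                \<le> C * omega_rate p C\<^sub>L d N)"
  proof (rule exI[of _ "4 + 3 / \<delta>"], intro allI impI conjI)
    fix p Z \<gamma> L d z Tstar and M :: "nat \<Rightarrow> 'a measure"
    assume E: "exploration_setting p M Z \<gamma> L d z Tstar"
    let ?P = "\<lambda>N. measure (M N) {\<omega> \<in> space (M N). \<bar>time_error N Z Tstar \<omega>\<bar> \<ge> \<delta>}"
    show ev: "\<forall>\<^sub>F N in sequentially. ?P N \<le> (4 + 3 / \<delta>) * omega_rate p L d N"
      by (rule eventually_deviation_bound[OF E \<delta>])
    have le1: "?P N \<le> 1" if "N \<ge> 1" for N
      using exploration_setting_chain(2)[OF E that] by (rule prob_space.prob_le_1)
    obtain C where "C \<ge> 4 + 3 / \<delta>"
        "\<And>N. N \<ge> 1 \<Longrightarrow> omega_rate p L d N > 0 \<Longrightarrow> ?P N \<le> C * omega_rate p L d N"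
      by (rule uniform_constant[of ?P _ "omega_rate p L d" 1, OF ev le1]) blast+
    then show "\<exists>C::real. \<forall>N\<ge>1. omega_rate p L d N > 0 \<longrightarrow> ?P N \<le> C * omega_rate p L d N"
      by blast
  qed
next
  fix p Z \<gamma> L d z Tstar and M :: "nat \<Rightarrow> 'a measure"
  assume E: "exploration_setting p M Z \<gamma> L d z Tstar"
  let ?n = "\<lambda>N. L2_norm_rv (M N) (time_error N Z Tstar)" and ?w = "omega_rate p L d"
  obtain C where C: "C \<ge> 3 + 4 * (1 + Tstar)" "\<And>N. N \<ge> 1 \<Longrightarrow> ?w N > 0 \<Longrightarrow> ?n N \<le> C * ?w N"
    by (rule uniform_constant[of ?n _ ?w "1 + Tstar", OF eventually_L2_bound[OF E] time_error_crude(2)[OF E]])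
       blast+
  \<comment> \<open>\<open>C\<close> dominates the eventual constant and the rate is nonnegative, so
    \<open>C\<close> serves here too, including any large \<open>N\<close> of zero rate.\<close>
  have "\<forall>\<^sub>F N in sequentially. ?n N \<le> C * ?w N"
    using eventually_L2_bound[OF E] eventually_ge_at_top[of 1]
  proof eventually_elim
    case (elim N)
    then show ?case
      using mult_right_mono[OF C(1) omega_rate_nonneg[OF E elim(2)]] by linarith
  qed
  then have "\<forall>\<^sub>F N in sequentially. integrable (M N) (\<lambda>\<omega>. \<bar>time_error N Z Tstar \<omega>\<bar>\<^sup>2) \<and> ?n N \<le> C * ?w N"
    using eventually_ge_at_top[of 1]
  proof eventually_elim
    case (elim N)
    then show ?case using time_error_crude(1)[OF E] by simp
  qed
  then show "\<exists>C::real.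
      (\<forall>\<^sub>F N in sequentially. integrable (M N) (\<lambda>\<omega>. \<bar>time_error N Z Tstar \<omega>\<bar>\<^sup>2) \<and> ?n N \<le> C * ?w N) \<and>
      (\<forall>N\<ge>1. ?w N > 0 \<longrightarrow> integrable (M N) (\<lambda>\<omega>. \<bar>time_error N Z Tstar \<omega>\<bar>\<^sup>2) \<and> ?n N \<le> C * ?w N)"
    using C(2) time_error_crude(1)[OF E] by (intro exI[of _ C]) auto
qed

end
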